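(* Let $Q\subset\mathbb{R}^2$ be any trapezoid and let $T\subset\mathbb{R}^2$ be any convex body. Then Viterbo's conjecture holds for the Lagrangian product $Q\times T\subset\mathbb{R}^2(x)\times\mathbb{R}^2(y)=\mathbb{R}^4$, i.e. $$\mathrm{vol}(Q\times T)\;\ge\;\frac{c_{EHZ}(Q\times T)^2}{2}.$$
   Context: Identify $\mathbb{R}^4=\mathbb{R}^2(x)\times\mathbb{R}^2(y)$ with coordinates $(x_1,x_2,y_1,y_2)$ and the standard symplectic form $\omega=dx_1\wedge dy_1+dx_2\wedge dy_2$. Let $J=\begin{pmatrix}0&I_2\\-I_2&0\end{pmatrix}$. A convex body is a compact convex set with nonempty interior. For a convex body $C\subset\mathbb{R}^4$ with $0$ in its interior let $\mu_C(z)=\min\{t\ge 0: z\in tC\}$ be its gauge and $\partial\mu_C$ its subdifferential. A closed characteristic on $\partial C$ is an absolutely continuous loop $x:\mathbb{R}/\mathbb{Z}\to\mathbb{R}^4$ with $\mu_C(x(t))=1$ for all $t$ and $\dot x(t)\in\mathbb{R}_{>0}\,J\,\partial\mu_C(x(t))$ for almost every $t$; its action is $\mathbb{A}(x)=-\frac12\int_0^1\langle J\dot x(t),x(t)\rangle\,dt$. The EHZ-capacity is $c_{EHZ}(C)=\min\{\mathbb{A}(x): x \text{ closed characteristic on }\partial C\}$; it is translation invariant, which defines it for every convex body in $\mathbb{R}^4$. $\mathrm{vol}$ denotes Lebesgue measure (area in $\mathbb{R}^2$, 4-volume in $\mathbb{R}^4$). A trapezoid is a convex quadrilateral in $\mathbb{R}^2$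 with at least one pair of parallel sides; triangles are also counted as (degenerate) trapezoids. *)

theory Defs
  imports "HOL-Analysis.Analysis"
begin

type_synonym R2 = "real^2"
type_synonym R4 = "(real^2) \<times> (real^2)"

definition convex_body :: "'a::euclidean_space set \<Rightarrow> bool" where
  "convex_body C \<longleftrightarrow> compact C \<and> convex C \<and> interior C \<noteq> {}"

definition Jmat :: "R4 \<Rightarrow> R4" where
  "Jmat z = (snd z, - fst z)"

definition gauge_fun :: "'a::euclidean_space set \<Rightarrow> 'a \<Rightarrow> real" where
  "gauge_fun C z = Inf {t. t \<ge> 0 \<and> z \<in> (\<lambda>v. t *\<^sub>R v) ` C}"

definition subdiff :: "('a::euclidean_space \<Rightarrow> real) \<Rightarrow> 'a \<Rightarrow> 'a set" where
  "subdiff f z = {p. \<forall>w. f w \<ge> f z + inner p (w - z)}"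

definition abs_cont_on :: "real \<Rightarrow> real \<Rightarrow> (real \<Rightarrow> 'a::real_normed_vector) \<Rightarrow> bool" where
  "abs_cont_on a b f \<longleftrightarrow>
     (\<forall>e>0. \<exists>d>0. \<forall>(n::nat) (l::nat \<Rightarrow> real) (r::nat \<Rightarrow> real).
        (\<forall>i<n. a \<le> l i \<and> l i \<le> r i \<and> r i \<le> b) \<and>
        (\<forall>i<n. \<forall>j<n. i \<noteq> j \<longrightarrow> r i \<le> l j \<or> r j \<le> l i) \<and>
        (\<Sum>i<n. r i - l i) < d
        \<longrightarrow> (\<Sum>i<n. norm (f (r i) - f (l i))) < e)"

text \<open>A loop R/Z \<rightarrow> R^4 is represented as a 1-periodic function on the reals.\<close>
definition closed_characteristic :: "R4 set \<Rightarrow> (real \<Rightarrow> R4) \<Rightarrow> bool" where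
  "closed_characteristic C x \<longleftrightarrow>
     (\<forall>t. x (t + 1) = x t) \<and>
     abs_cont_on 0 1 x \<and>
     (\<forall>t. gauge_fun C (x t) = 1) \<and>
     (AE t in lborel. t \<in> {0..1} \<longrightarrow>
        x differentiable (at t) \<and>
        vector_derivative x (at t) \<in>
          {c *\<^sub>R Jmat p | c p. c > 0 \<and> p \<in> subdiff (gauge_fun C) (x t)})"

definition action :: "(real \<Rightarrow> R4) \<Rightarrow> real" where
  "action x = - (1/2) * (LINT t:{0..1}|lborel. inner (Jmat (vector_derivative x (at t))) (x t))"

text \<open>EHZ capacity for bodies with 0 in the interior (the minimum of the actions).\<close>
definition c_EHZ0 :: "R4 set \<Rightarrow> real" where
  "c_EHZ0 C = Inf (action ` {x. closed_characteristic C x})"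

text \<open>Extension to arbitrary convex bodies by translation invariance.\<close>
definition c_EHZ :: "R4 set \<Rightarrow> real" where
  "c_EHZ C = (let p = (SOME p. p \<in> interior C) in c_EHZ0 ((\<lambda>z. z - p) ` C))"

text \<open>Trapezoids: convex quadrilaterals with a pair of parallel sides, or triangles.
  A convex quadrilateral is the convex hull of 4 points none of which lies in the
  convex hull of the other three. A partition of the vertices into two pairs
  {a,b},{c,d} with b - a parallel to d - c is necessarily a pair of opposite sides
  (the diagonals of a convex quadrilateral are never parallel).\<close>
definition trapezoid :: "R2 set \<Rightarrow> bool" where
  "trapezoid Q \<longleftrightarrow>
     (\<exists>a b c. \<not> collinear {a, b, c} \<and> Q = convex hull {a, b, c}) \<or>
     (\<exists>a b c d. card {a, b, c, d} = 4 \<and> Q = convex hull {a, b, c, d} \<and>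
        (\<forall>v\<in>{a, b, c, d}. v \<notin> convex hull ({a, b, c, d} - {v})) \<and>
        (\<exists>k::real. d - c = k *\<^sub>R (b - a)))"

end

(*
  A T-billiard in Q alternates between moving the position q along a normal of T and moving the
  momentum p against a normal of Q. Write Q = {a + s e + t f | 0 <= t <= 1, 0 <= s, s + \<kappa> t <= 1},
  with \<kappa> = 1 for triangles and \<kappa> = 0 for parallelograms, and let E, F be the basis dual to e, f.
  A longest chord A, A + s F of T and the largest homothets of the two triangles with vertices
  0, E, - \<kappa> F and 0, - E - \<kappa> F, - \<kappa> F in T carry, by Lagrange duality, normals of T adding up to
  zero. These are the edges of a closed polygon q, and each such polygon that fits into Q is a
  closed characteristic whose action is the size of the chord or homothet. If the polygon does not
  fit, then one of the other two sizes is smaller; hence c = c_EHZ is at most each of the three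
  sizes. So T contains a chord and two triangles of size c, which forces
  (2 - \<kappa>) |det (e, f)| vol T >= c^2, while vol Q = |det (e, f)| (2 - \<kappa>) / 2.
*)
theory Submission
  imports Defs
begin

section \<open>Closed characteristics along polygons\<close>


text \<open>The capacity is an infimum, so an estimate from above needs only one explicit
  characteristic; no minimizer has to be identified. The multipliers \<open>u1\<close>,
  \<open>u2\<close>, \<open>u3\<close> of an extremal homothet serve twice. If the polygon with
  these edges fits into Q, they produce a characteristic. If it sticks out of Q, the same supporting
  inequalities, tested on a competing homothet in T, bound the size of that competitor strictly. The
  factor 2 - \<kappa> comes from the overlap of the two triangles in T. Let W be the distance
  between the levels of their two apexes. One lower bound for the area, W c / 2, grows with W; the
  other, c (2 c - W (1 - \<kappa>)) / 2, does not. They meet at W = 2 c / (2 - \<kappa>), with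
  common value c^2 / (2 - \<kappa>).\<close>

lemma gauge_fun_normal:
  fixes C :: "'a::euclidean_space set"
  assumes C: "0 \<in> interior C" and z: "z \<in> C" and v: "v \<noteq> 0"
    and normal: "\<And>w. w \<in> C \<Longrightarrow> inner v w \<le> inner v z"
  shows "gauge_fun C z = 1" and "\<exists>c>0. \<exists>p\<in>subdiff (gauge_fun C) z. v = c *\<^sub>R p"
proof -
  obtain r where r: "r > 0" "ball 0 r \<subseteq> C"
    using C by (auto simp: mem_interior)
  \<comment> \<open>This support value is positive: test the normal on a short multiple of
    \<open>v\<close> inside the ball. Dividing \<open>v\<close> by it gives a linear form that is at
    most 1 on \<open>C\<close>, hence below the gauge everywhere, with equality at
    \<open>z\<close>.\<close>
  define c where "c = inner v z"
  have "(r / 2 / norm v) *\<^sub>R v \<in> C"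
    using r v by (intro subsetD[OF r(2)]) auto
  from normal[OF this] have "r / 2 / norm v * (inner v v) \<le> c"
    by (simp add: c_def)
  moreover have "r / 2 / norm v * (inner v v) > 0"
    using r v by auto
  ultimately have c: "c > 0" by linarith
  define p where "p = (1 / c) *\<^sub>R v"
  have pz: "inner p z = 1" and pC: "inner p y \<le> 1" if "y \<in> C" for y
    using c normal[OF that] by (simp_all add: p_def c_def field_simps)
  have lower: "gauge_fun C w \<ge> inner p w" for w
    unfolding gauge_fun_def
  proof (rule cInf_greatest)
    \<comment> \<open>Large enough for \<open>w\<close> divided by \<open>t\<close> to land in the
      ball, so the infimum runs over a nonempty set.\<close>
    define t where "t = 2 * norm w / r + 1"
    have t: "t > 0" using r by (simp add: t_def add_nonneg_pos)
    have "norm w < r * t" using r by (simp add: t_def distrib_left add_nonneg_pos)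
    then have "(1 / t) *\<^sub>R w \<in> C"
      using t r by (intro subsetD[OF r(2)]) (auto simp: field_simps)
    then have "w \<in> (\<lambda>v. t *\<^sub>R v) ` C"
      using t by (intro image_eqI[of _ _ "(1 / t) *\<^sub>R w"]) auto
    then show "{t. t \<ge> 0 \<and> w \<in> (\<lambda>v. t *\<^sub>R v) ` C} \<noteq> {}"
      using t by (auto intro!: exI[of _ t])
  next
    fix t assume "t \<in> {t. t \<ge> 0 \<and> w \<in> (\<lambda>v. t *\<^sub>R v) ` C}"
    then obtain y where "t \<ge> 0" "y \<in> C" "w = t *\<^sub>R y" by auto
    then show "inner p w \<le> t"
      using mult_left_mono[OF pC[of y], of t] by simp
  qed
  have "gauge_fun C z \<le> 1"
    unfolding gauge_fun_def using z by (intro cInf_lower) (auto intro!: bdd_belowI)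
  with lower[of z] pz[OF z] show one: "gauge_fun C z = 1" by simp
  have "p \<in> subdiff (gauge_fun C) z"
    unfolding subdiff_def using lower pz[OF z] by (simp add: one inner_diff_right)
  moreover have "v = c *\<^sub>R p" using c by (simp add: p_def)
  ultimately show "\<exists>c>0. \<exists>p\<in>subdiff (gauge_fun C) z. v = c *\<^sub>R p"
    using c by blast
qed

lemma Jmat_simps [simp]:
  "Jmat (c *\<^sub>R a) = c *\<^sub>R Jmat a" "Jmat (- a) = - Jmat a"
  "Jmat (Jmat a) = - a" "inner (Jmat a) a = 0" "Jmat 0 = 0"
  by (auto simp: Jmat_def prod_eq_iff inner_prod_def inner_commute)

lemma Jmat_diff: "Jmat (a - b) = Jmat a - Jmat b"
  by (simp add: Jmat_def)

text \<open>The subgradient inequality, evaluated at the origin, makes \<open>inner p (x t)\<close>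
  positive, and the integrand of the action is a positive multiple of it. This is what bounds the
  set of actions from below, so that its infimum can be compared with a single action.\<close>

lemma action_nonneg:
  assumes x: "closed_characteristic C x" and C: "0 \<in> C"
  shows "action x \<ge> 0"
proof -
  have g0: "gauge_fun C 0 \<le> 0"
    unfolding gauge_fun_def using C
    by (intro cInf_lower) (auto intro!: bdd_belowI image_eqI[of _ _ 0])
  have "AE t in lborel. 0 \<le> - (indicator {0..1} t *\<^sub>R inner (Jmat (vector_derivative x (at t))) (x t))"
  proof -
    have "AE t in lborel. t \<in> {0..1} \<longrightarrow>
        x differentiable (at t) \<and>
        vector_derivative x (at t) \<in>
          {c *\<^sub>R Jmat p | c p. c > 0 \<and> p \<in> subdiff (gauge_fun C) (x t)}"
      using x by (simp add: closed_characteristic_def)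
    then show ?thesis
    proof (rule AE_mp, intro AE_I2 impI)
      fix t
      assume A: "t \<in> {0..1} \<longrightarrow>
        x differentiable (at t) \<and>
        vector_derivative x (at t) \<in>
          {c *\<^sub>R Jmat p | c p. c > 0 \<and> p \<in> subdiff (gauge_fun C) (x t)}"
      show "0 \<le> - (indicator {0..1} t *\<^sub>R inner (Jmat (vector_derivative x (at t))) (x t))"
      proof (cases "t \<in> {0..1}")
        case True
        with A obtain c p where cp: "c > 0" "p \<in> subdiff (gauge_fun C) (x t)"
            "vector_derivative x (at t) = c *\<^sub>R Jmat p" by auto
        have "gauge_fun C 0 \<ge> gauge_fun C (x t) + inner p (0 - x t)"
          using cp(2) unfolding subdiff_def by blast
        moreover have "gauge_fun C (x t) = 1"
          using x by (simp add: closed_characteristic_def)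
        ultimately have "inner p (x t) \<ge> 0" using g0 by simp
        then show ?thesis using cp by simp
      qed simp
    qed
  qed
  from integral_nonneg_AE[OF this] show ?thesis
    by (simp add: action_def set_lebesgue_integral_def)
qed

lemma abs_cont_on_Lipschitz:
  assumes L: "\<And>s t. a \<le> s \<Longrightarrow> s \<le> t \<Longrightarrow> t \<le> b \<Longrightarrow> norm (f t - f s) \<le> K * (t - s)"
  shows "abs_cont_on a b f"
  unfolding abs_cont_on_def
proof (intro allI impI)
  fix e :: real assume e: "e > 0"
  show "\<exists>d>0. \<forall>(n::nat) (l::nat \<Rightarrow> real) (r::nat \<Rightarrow> real).
        (\<forall>i<n. a \<le> l i \<and> l i \<le> r i \<and> r i \<le> b) \<and>
        (\<forall>i<n. \<forall>j<n. i \<noteq> j \<longrightarrow> r i \<le> l j \<or> r j \<le> l i) \<and>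
        (\<Sum>i<n. r i - l i) < d
        \<longrightarrow> (\<Sum>i<n. norm (f (r i) - f (l i))) < e"
  proof (intro exI[of _ "e / (\<bar>K\<bar> + 1)"] conjI allI impI)
    show "e / (\<bar>K\<bar> + 1) > 0" using e by simp
    fix n :: nat and l r :: "nat \<Rightarrow> real"
    assume A: "(\<forall>i<n. a \<le> l i \<and> l i \<le> r i \<and> r i \<le> b) \<and>
        (\<forall>i<n. \<forall>j<n. i \<noteq> j \<longrightarrow> r i \<le> l j \<or> r j \<le> l i) \<and>
        (\<Sum>i<n. r i - l i) < e / (\<bar>K\<bar> + 1)"
    have "(\<Sum>i<n. norm (f (r i) - f (l i))) \<le> (\<Sum>i<n. (\<bar>K\<bar> + 1) * (r i - l i))"
    proof (rule sum_mono)
      fix i assume "i \<in> {..<n}"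
      then have i: "a \<le> l i" "l i \<le> r i" "r i \<le> b" using A by auto
      have "K * (r i - l i) \<le> (\<bar>K\<bar> + 1) * (r i - l i)"
        using i by (intro mult_right_mono) auto
      with L[OF i] show "norm (f (r i) - f (l i)) \<le> (\<bar>K\<bar> + 1) * (r i - l i)" by linarith
    qed
    also have "\<dots> = (\<bar>K\<bar> + 1) * (\<Sum>i<n. r i - l i)" by (simp add: sum_distrib_left)
    also have "\<dots> < e" using A by (auto simp: field_simps)
    finally show "(\<Sum>i<n. norm (f (r i) - f (l i))) < e" .
  qed
qed

text \<open>The polygon is parametrized proportionally to arc length, so that edges of length zero
  take no time; the clamped summands trace out the edges one after another.\<close>

lemma closed_characteristic_polygon:
  fixes z :: "nat \<Rightarrow> R4"
  assumes C: "convex C" "0 \<in> interior C"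
    and zC: "\<And>k. k \<le> N \<Longrightarrow> z k \<in> C" and closed: "z N = z 0"
    and move: "m < N" "z (Suc m) \<noteq> z m"
    and normal: "\<And>k w. k < N \<Longrightarrow> w \<in> C \<Longrightarrow> inner (Jmat (z (Suc k) - z k)) (w - z k) \<ge> 0"
  obtains x where "closed_characteristic C x"
    and "action x = - (1/2) * (\<Sum>k<N. inner (Jmat (z (Suc k) - z k)) (z k))"
proof -
  define L where "L = (\<Sum>k<N. norm (z (Suc k) - z k))"
  have "L > 0" unfolding L_def using move
    by (intro sum_pos2[of _ m]) auto
  define \<tau> where "\<tau> n = (\<Sum>k<n. norm (z (Suc k) - z k)) / L" for n
  have \<tau>0: "\<tau> 0 = 0" and \<tau>N: "\<tau> N = 1"
    using \<open>L > 0\<close> by (auto simp: \<tau>_def L_def)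
  have \<tau>Suc: "\<tau> (Suc n) - \<tau> n = norm (z (Suc n) - z n) / L" for n
    by (simp add: \<tau>_def add_divide_distrib)
  have \<tau>_le_Suc: "\<tau> n \<le> \<tau> (Suc n)" for n
    using \<tau>Suc[of n] divide_nonneg_pos[OF norm_ge_zero \<open>L > 0\<close>, of "z (Suc n) - z n"] by linarith
  have \<tau>_mono: "\<tau> i \<le> \<tau> j" if "i \<le> j" for i j
    using lift_Suc_mono_le[of \<tau>, OF _ that] \<tau>_le_Suc by auto
  \<comment> \<open>An edge of length zero gets velocity zero, so the next identity holds for it
    too.\<close>
  define d where "d k = (1 / (\<tau> (Suc k) - \<tau> k)) *\<^sub>R (z (Suc k) - z k)" for k
  have d: "(\<tau> (Suc k) - \<tau> k) *\<^sub>R d k = z (Suc k) - z k" for k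
    using \<open>L > 0\<close> by (cases "z (Suc k) = z k") (auto simp: d_def \<tau>Suc)
  have dnz: "d k \<noteq> 0" if "\<tau> k < \<tau> (Suc k)" for k
    using that \<tau>Suc[of k] by (auto simp: d_def)
  define cl where "cl k t = max 0 (min (t - \<tau> k) (\<tau> (Suc k) - \<tau> k))" for k t
  define y where "y t = z 0 + (\<Sum>k<N. cl k t *\<^sub>R d k)" for t
  \<comment> \<open>Periodicity on the whole line comes from \<open>frac\<close>; on the closed unit
    interval \<open>x\<close> and \<open>y\<close> agree because \<open>y\<close> has the same value
    at 0 and 1.\<close>
  define x where "x t = y (frac t)" for t
  have y_eq: "y t = z j + (t - \<tau> j) *\<^sub>R d j" if j: "j < N" "\<tau> j \<le> t" "t \<le> \<tau> (Suc j)" for j t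
  proof -
    have *: "cl k t *\<^sub>R d k = (if k < j then z (Suc k) - z k else if k = j then (t - \<tau> j) *\<^sub>R d j else 0)"
      if "k < N" for k
    proof -
      consider "k < j" | "k = j" | "j < k" by linarith
      then show ?thesis
      proof cases
        case 1
        then have "\<tau> (Suc k) \<le> t" using \<tau>_mono[of "Suc k" j] j by linarith
        then have "cl k t = \<tau> (Suc k) - \<tau> k" using \<tau>_le_Suc[of k] by (simp add: cl_def)
        with 1 d show ?thesis by simp
      next
        case 2
        with j show ?thesis by (simp add: cl_def)
      next
        case 3
        then have "t \<le> \<tau> k" using \<tau>_mono[of "Suc j" k] j by linarith
        with 3 show ?thesis by (simp add: cl_def)
      qed
    qed
    have "(\<Sum>k<N. cl k t *\<^sub>R d k) = (\<Sum>k<N. if k < j then z (Suc k) - z k else if k = j then (t - \<tau> j) *\<^sub>R d j else 0)"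
      using * by (intro sum.cong) auto
    also have "\<dots> = (\<Sum>k<Suc j. if k < j then z (Suc k) - z k else if k = j then (t - \<tau> j) *\<^sub>R d j else 0)"
      using j by (intro sum.mono_neutral_right) auto
    also have "\<dots> = (\<Sum>k<j. z (Suc k) - z k) + (t - \<tau> j) *\<^sub>R d j"
      by simp
    also have "(\<Sum>k<j. z (Suc k) - z k) = z j - z 0"
      by (rule sum_lessThan_telescope)
    finally show ?thesis by (simp add: y_def)
  qed
  \<comment> \<open>The strict upper bound selects an edge of positive length, whose velocity is
    nonzero and therefore provides a normal.\<close>
  have find_ge: "\<exists>j<n. \<tau> j \<le> t \<and> t < \<tau> (Suc j)" if "0 \<le> t" "t < \<tau> n" for t n
    using that
  proof (induction n)
    case (Suc n)
    then show ?case by (cases "t < \<tau> n") (auto intro: less_SucI)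
  qed (simp add: \<tau>0)
  have y1: "y 1 = z 0"
  proof -
    have "cl k 1 *\<^sub>R d k = z (Suc k) - z k" if "k < N" for k
    proof -
      have "\<tau> (Suc k) \<le> 1" using \<tau>_mono[of "Suc k" N] that \<tau>N by simp
      then have "cl k 1 = \<tau> (Suc k) - \<tau> k" using \<tau>_le_Suc[of k] by (simp add: cl_def)
      with d show ?thesis by simp
    qed
    then have "y 1 = z 0 + (\<Sum>k<N. z (Suc k) - z k)" by (simp add: y_def)
    also have "\<dots> = z 0" by (subst sum_lessThan_telescope) (simp add: closed)
    finally show ?thesis .
  qed
  have y0: "y 0 = z 0"
  proof -
    have "cl k 0 = 0" for k
      using \<tau>_mono[of 0 k] \<tau>0 by (simp add: cl_def)
    then show ?thesis by (simp add: y_def)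
  qed
  have xy: "x t = y t" if "0 \<le> t" "t \<le> 1" for t
  proof (cases "t = 1")
    case False
    with that have "frac t = t" by (simp add: frac_eq)
    then show ?thesis by (simp add: x_def)
  qed (simp add: x_def y0 y1)
  have point: "y t \<in> C \<and> (\<forall>w\<in>C. inner (- Jmat (d j)) w \<le> inner (- Jmat (d j)) (y t))"
    if j: "j < N" "\<tau> j \<le> t" "t < \<tau> (Suc j)" for j t
  proof
    define \<theta> where "\<theta> = (t - \<tau> j) / (\<tau> (Suc j) - \<tau> j)"
    have \<theta>: "0 \<le> \<theta>" "\<theta> \<le> 1" using j by (auto simp: \<theta>_def field_simps)
    have yt: "y t = z j + (t - \<tau> j) *\<^sub>R d j" using y_eq j by simp
    also have "\<dots> = (1 - \<theta>) *\<^sub>R z j + \<theta> *\<^sub>R z (Suc j)"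
      by (simp add: d_def \<theta>_def algebra_simps)
    finally show "y t \<in> C"
      using convexD_alt[OF C(1) zC[of j] zC[of "Suc j"] \<theta>] j by simp
    show "\<forall>w\<in>C. inner (- Jmat (d j)) w \<le> inner (- Jmat (d j)) (y t)"
    proof
      fix w assume w: "w \<in> C"
      have "0 \<le> 1 / (\<tau> (Suc j) - \<tau> j) * inner (Jmat (z (Suc j) - z j)) (w - z j)"
        using normal[OF j(1) w] j by simp
      also have "\<dots> = inner (Jmat (d j)) (w - z j)"
        by (simp add: d_def)
      also have "\<dots> = inner (Jmat (d j)) (w - y t)"
        unfolding yt by (simp add: inner_diff_right inner_add_right)
      finally show "inner (- Jmat (d j)) w \<le> inner (- Jmat (d j)) (y t)"
        by (simp add: inner_diff_right)
    qed
  qed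
  have Jd: "- Jmat (d j) \<noteq> 0" if "\<tau> j < \<tau> (Suc j)" for j
    using dnz[OF that] Jmat_simps(3)[of "d j"] by (metis Jmat_simps(5) neg_equal_0_iff_equal)
  define P where "P = \<tau> ` {..N}"
  have find_gt: "\<exists>j<N. \<tau> j < t \<and> t < \<tau> (Suc j)" if "t \<in> {0..1}" "t \<notin> P" for t
  proof -
    have "t \<noteq> 1" using that \<tau>N by (auto simp: P_def)
    with that obtain j where j: "j < N" "\<tau> j \<le> t" "t < \<tau> (Suc j)"
      using find_ge[of t N] \<tau>N by auto
    moreover have "\<tau> j \<noteq> t" using that j by (auto simp: P_def)
    ultimately show ?thesis by force
  qed
  have deriv: "(x has_vector_derivative d j) (at t)" if j: "j < N" "\<tau> j < t" "t < \<tau> (Suc j)" for j t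
  proof (rule has_vector_derivative_transform_within_open)
    show "((\<lambda>t. z j + (t - \<tau> j) *\<^sub>R d j) has_vector_derivative d j) (at t)"
      by (auto intro!: derivative_eq_intros)
    show "open {\<tau> j<..<\<tau> (Suc j)}" "t \<in> {\<tau> j<..<\<tau> (Suc j)}" using j by auto
    fix s assume s: "s \<in> {\<tau> j<..<\<tau> (Suc j)}"
    have "0 \<le> s" "s \<le> 1"
      using s \<tau>_mono[of 0 j] \<tau>_mono[of "Suc j" N] j \<tau>0 \<tau>N by auto
    then show "z j + (s - \<tau> j) *\<^sub>R d j = x s"
      using s j y_eq[of j s] by (simp add: xy)
  qed
  have "AE t in lborel. t \<notin> P"
    by (intro AE_not_in finite_imp_null_set_lborel) (simp add: P_def)
  then have AE: "AE t in lborel. t \<in> {0..1} \<longrightarrow>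
        x differentiable (at t) \<and>
        vector_derivative x (at t) \<in>
          {c *\<^sub>R Jmat p | c p. c > 0 \<and> p \<in> subdiff (gauge_fun C) (x t)}"
  proof (rule AE_mp, intro AE_I2 impI)
    fix t :: real assume t: "t \<notin> P" "t \<in> {0..1}"
    then obtain j where j: "j < N" "\<tau> j < t" "t < \<tau> (Suc j)" using find_gt by blast
    have pt: "x t \<in> C" "\<And>w. w \<in> C \<Longrightarrow> inner (- Jmat (d j)) w \<le> inner (- Jmat (d j)) (x t)"
      using point[of j t] j t xy by auto
    obtain c p where "c > 0" "p \<in> subdiff (gauge_fun C) (x t)" "- Jmat (d j) = c *\<^sub>R p"
      using gauge_fun_normal(2)[OF C(2) pt(1) Jd pt(2)] j by auto
    moreover from this(3) have "d j = c *\<^sub>R Jmat p"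
      by (metis Jmat_simps(1,2,3) minus_minus)
    ultimately show "x differentiable (at t) \<and>
        vector_derivative x (at t) \<in>
          {c *\<^sub>R Jmat p | c p. c > 0 \<and> p \<in> subdiff (gauge_fun C) (x t)}"
      using deriv[OF j] vector_derivative_at[OF deriv[OF j]] 
      by (intro conjI CollectI exI[of _ c] exI[of _ p]) (auto intro: differentiableI_vector)
  qed
  have gauge: "gauge_fun C (x t) = 1" for t
  proof -
    obtain j where j: "j < N" "\<tau> j \<le> frac t" "frac t < \<tau> (Suc j)"
      using find_ge[of "frac t" N] \<tau>N frac_lt_1[of t] by auto
    then have pt: "x t \<in> C" "\<And>w. w \<in> C \<Longrightarrow> inner (- Jmat (d j)) w \<le> inner (- Jmat (d j)) (x t)"
      using point[of j "frac t"] by (auto simp: x_def)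
    show ?thesis
      using gauge_fun_normal(1)[OF C(2) pt(1) Jd pt(2)] j by auto
  qed
  have "abs_cont_on 0 1 x"
  proof (rule abs_cont_on_Lipschitz)
    fix s t :: real assume st: "0 \<le> s" "s \<le> t" "t \<le> 1"
    have "norm (x t - x s) = norm (\<Sum>k<N. (cl k t - cl k s) *\<^sub>R d k)"
      using st by (simp add: xy y_def sum_subtractf scaleR_diff_left)
    also have "\<dots> \<le> (\<Sum>k<N. norm ((cl k t - cl k s) *\<^sub>R d k))"
      by (rule norm_sum)
    also have "\<dots> \<le> (\<Sum>k<N. (t - s) * norm (d k))"
    proof (rule sum_mono)
      fix k
      have "\<bar>cl k t - cl k s\<bar> \<le> t - s"
        using st by (auto simp: cl_def max_def min_def)
      then show "norm ((cl k t - cl k s) *\<^sub>R d k) \<le> (t - s) * norm (d k)"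
        by (simp add: mult_right_mono)
    qed
    also have "\<dots> = (\<Sum>k<N. norm (d k)) * (t - s)"
      by (simp add: sum_distrib_left mult.commute)
    finally show "norm (x t - x s) \<le> (\<Sum>k<N. norm (d k)) * (t - s)" .
  qed
  with AE gauge have "closed_characteristic C x"
    by (simp add: closed_characteristic_def x_def frac_1_eq)
  moreover have "action x = - (1/2) * (\<Sum>k<N. inner (Jmat (z (Suc k) - z k)) (z k))"
  proof -
    \<comment> \<open>Along an edge the integrand is constant: \<open>x t\<close> differs from
      \<open>z k\<close> by a multiple of \<open>d k\<close>, which is orthogonal to
      \<open>Jmat (d k)\<close>. Off the finite set \<open>P\<close> of breakpoints the integrand is
      thus a step function.\<close>
    let ?b = "\<lambda>k. inner (Jmat (d k)) (z k)"
    have "(LINT t:{0..1}|lborel. inner (Jmat (vector_derivative x (at t))) (x t))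
      = (\<integral>t. (\<Sum>k<N. indicator {\<tau> k<..<\<tau> (Suc k)} t * ?b k) \<partial>lborel)"
      unfolding set_lebesgue_integral_def
    proof (rule integral_discrete_difference[where X = P])
      show "countable P" by (simp add: P_def countable_finite)
      fix t assume t: "t \<in> space lborel" "t \<notin> P"
      show "indicator {0..1} t *\<^sub>R inner (Jmat (vector_derivative x (at t))) (x t)
        = (\<Sum>k<N. indicator {\<tau> k<..<\<tau> (Suc k)} t * ?b k)"
      proof (cases "t \<in> {0..1}")
        case True
        then obtain j where j: "j < N" "\<tau> j < t" "t < \<tau> (Suc j)" using find_gt t by blast
        have "x t = z j + (t - \<tau> j) *\<^sub>R d j"
          using True j y_eq[of j t] by (simp add: xy)
        then have "inner (Jmat (vector_derivative x (at t))) (x t) = ?b j"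
          using vector_derivative_at[OF deriv[OF j]] by (simp add: inner_add_right)
        moreover have "(\<Sum>k<N. indicator {\<tau> k<..<\<tau> (Suc k)} t * ?b k) = (\<Sum>k\<in>{j}. indicator {\<tau> k<..<\<tau> (Suc k)} t * ?b k)"
        proof (rule sum.mono_neutral_right)
          show "\<forall>k\<in>{..<N} - {j}. indicator {\<tau> k<..<\<tau> (Suc k)} t * ?b k = 0"
          proof
            fix k assume "k \<in> {..<N} - {j}"
            then consider "Suc k \<le> j" | "Suc j \<le> k" by fastforce
            then have "t \<notin> {\<tau> k<..<\<tau> (Suc k)}"
            proof cases
              case 1 then show ?thesis using \<tau>_mono[of "Suc k" j] j by auto
            next
              case 2 then show ?thesis using \<tau>_mono[of "Suc j" k] j by auto
            qed
            then show "indicator {\<tau> k<..<\<tau> (Suc k)} t * ?b k = 0" by simp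
          qed
        qed (use j in auto)
        ultimately show ?thesis using True j by simp
      next
        case False
        have "t \<notin> {\<tau> k<..<\<tau> (Suc k)}" if "k < N" for k
          using False that \<tau>_mono[of 0 k] \<tau>_mono[of "Suc k" N] \<tau>0 \<tau>N by auto
        then show ?thesis using False by simp
      qed
    qed auto
    also have "\<dots> = (\<Sum>k<N. (\<tau> (Suc k) - \<tau> k) * ?b k)"
    proof (intro has_bochner_integral_integral_eq has_bochner_integral_sum has_bochner_integral_mult_left)
      fix k
      show "has_bochner_integral lborel (indicator {\<tau> k<..<\<tau> (Suc k)}) (\<tau> (Suc k) - \<tau> k)"
        using has_bochner_integral_real_indicator[of "{\<tau> k<..<\<tau> (Suc k)}" lborel] \<tau>_le_Suc[of k] by simp
    qed
    also have "\<dots> = (\<Sum>k<N. inner (Jmat (z (Suc k) - z k)) (z k))"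
      by (intro sum.cong refl, subst d[symmetric]) simp
    finally show ?thesis by (simp add: action_def)
  qed
  ultimately show thesis using that by blast
qed


text \<open>The edges of a closed polygon add up to zero, so its action does not change when the
  body is moved to whatever base point \<open>SOME\<close> picks. Nonnegativity is recorded too: it
  relies on the polygon as a witness that characteristics exist, and it is required once the upper
  bounds are squared.\<close>

lemma c_EHZ_polygon:
  fixes z :: "nat \<Rightarrow> R4"
  assumes C: "convex C" "interior C \<noteq> {}"
    and zC: "\<And>k. k \<le> N \<Longrightarrow> z k \<in> C" and closed: "z N = z 0"
    and move: "m < N" "z (Suc m) \<noteq> z m"
    and normal: "\<And>k w. k < N \<Longrightarrow> w \<in> C \<Longrightarrow> inner (Jmat (z (Suc k) - z k)) (w - z k) \<ge> 0"
  shows "c_EHZ C \<ge> 0"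
    and "c_EHZ C \<le> - (1/2) * (\<Sum>k<N. inner (Jmat (z (Suc k) - z k)) (z k))"
proof -
  define p where "p = (SOME p. p \<in> interior C)"
  define C' where "C' = (\<lambda>z. z - p) ` C"
  define z' where "z' k = z k - p" for k
  have p: "p \<in> interior C" unfolding p_def using C(2) by (simp add: some_in_eq)
  have int: "0 \<in> interior C'"
    using p unfolding C'_def interior_translation_subtract by auto
  obtain x where x: "closed_characteristic C' x"
    and ax: "action x = - (1/2) * (\<Sum>k<N. inner (Jmat (z' (Suc k) - z' k)) (z' k))"
  proof (rule closed_characteristic_polygon[of C' N z' m])
    show "convex C'" unfolding C'_def using C(1) by (rule convex_translation_subtract)
    show "z' k \<in> C'" if "k \<le> N" for k using zC[OF that] by (simp add: z'_def C'_def)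
    show "z' N = z' 0" "z' (Suc m) \<noteq> z' m" using closed move by (simp_all add: z'_def)
    show "inner (Jmat (z' (Suc k) - z' k)) (w - z' k) \<ge> 0" if k: "k < N" and w: "w \<in> C'" for k w
    proof -
      obtain w' where "w' \<in> C" "w = w' - p" using w by (auto simp: C'_def)
      then show ?thesis using normal[OF k] by (simp add: z'_def)
    qed
  qed (use int move in auto)
  have "(\<Sum>k<N. inner (Jmat (z' (Suc k) - z' k)) (z' k))
      = (\<Sum>k<N. inner (Jmat (z (Suc k) - z k)) (z k)) - (\<Sum>k<N. inner (Jmat (z (Suc k) - z k)) p)"
    unfolding sum_subtractf[symmetric] by (intro sum.cong) (simp_all add: z'_def inner_diff_right)
  also have "(\<Sum>k<N. inner (Jmat (z (Suc k) - z k)) p)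
      = (\<Sum>k<N. inner (Jmat (z (Suc k))) p - inner (Jmat (z k)) p)"
    by (simp add: Jmat_diff inner_diff_left)
  also have "\<dots> = 0"
    unfolding sum_lessThan_telescope[of "\<lambda>k. inner (Jmat (z k)) p"] by (simp add: closed)
  finally have ax: "action x = - (1/2) * (\<Sum>k<N. inner (Jmat (z (Suc k) - z k)) (z k))"
    using ax by simp
  have c: "c_EHZ C = Inf (action ` {x. closed_characteristic C' x})"
    by (simp add: c_EHZ_def c_EHZ0_def C'_def p_def Let_def)
  have nn: "action y \<ge> 0" if "closed_characteristic C' y" for y
    using action_nonneg[OF that] int interior_subset by blast
  show "c_EHZ C \<ge> 0"
    unfolding c using x nn by (intro cInf_greatest) auto
  show "c_EHZ C \<le> - (1/2) * (\<Sum>k<N. inner (Jmat (z (Suc k) - z k)) (z k))"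
    unfolding c ax[symmetric] using x nn by (intro cInf_lower) (auto intro!: bdd_belowI[of _ 0])
qed

text \<open>Closed Minkowski billiard trajectories: the position moves from \<open>q j\<close> to \<open>q (Suc j)\<close> while
  the momentum rests at \<open>p j\<close>, then the momentum jumps to \<open>p (Suc j)\<close> at position \<open>q (Suc j)\<close>.\<close>

lemma c_EHZ_billiard:
  fixes q p :: "nat \<Rightarrow> R2"
  assumes conv: "convex Q" "convex T" and int: "interior Q \<noteq> {}" "interior T \<noteq> {}"
    and mem: "\<And>j. j \<le> m \<Longrightarrow> q j \<in> Q" "\<And>j. j \<le> m \<Longrightarrow> p j \<in> T"
    and closed: "q m = q 0" "p m = p 0"
    and move: "i < m" "q (Suc i) \<noteq> q i"
    and normal: "\<And>j y. j < m \<Longrightarrow> y \<in> T \<Longrightarrow> inner (q (Suc j) - q j) (y - p j) \<le> 0"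
      "\<And>j x. j < m \<Longrightarrow> x \<in> Q \<Longrightarrow> inner (p (Suc j) - p j) (x - q (Suc j)) \<ge> 0"
  shows "c_EHZ (Q \<times> T) \<ge> 0" and "c_EHZ (Q \<times> T) \<le> (\<Sum>j<m. inner (q (Suc j) - q j) (p j))"
proof -
  \<comment> \<open>The position index runs half a step ahead: an even \<open>n\<close> is followed
    by a move of \<open>q\<close>, an odd \<open>n\<close> by a jump of \<open>p\<close>.\<close>
  define z where "z n = (q (Suc n div 2), p (n div 2))" for n
  have even: "z (2 * j) = (q j, p j)" and odd: "z (Suc (2 * j)) = (q (Suc j), p j)" for j
    by (simp_all add: z_def)
  have zC: "z k \<in> Q \<times> T" if "k \<le> 2 * m" for k
    using that by (auto simp: z_def intro!: mem)
  have zn: "inner (Jmat (z (Suc k) - z k)) (w - z k) \<ge> 0" if "k < 2 * m" "w \<in> Q \<times> T" for k w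
  proof (cases "even k")
    case True
    then obtain j where j: "k = 2 * j" by blast
    with that normal(1)[of j "snd w"] show ?thesis
      by (auto simp: even odd Jmat_def inner_diff_left inner_diff_right)
  next
    case False
    then obtain j where j: "k = Suc (2 * j)" using oddE[OF False] by auto
    have "z (Suc k) = (q (Suc j), p (Suc j))" using even[of "Suc j"] by (simp add: j)
    with j that normal(2)[of j "fst w"] show ?thesis
      by (auto simp: odd Jmat_def inner_diff_left inner_diff_right)
  qed
  \<comment> \<open>Summation by parts turns the jump terms into a second copy of the move terms
    plus boundary terms, and the latter cancel on a closed orbit. The factor 1/2 in the action then
    removes the doubling.\<close>
  have sum: "(\<Sum>k<2 * n. inner (Jmat (z (Suc k) - z k)) (z k))
      = - 2 * (\<Sum>j<n. inner (q (Suc j) - q j) (p j)) + inner (q n) (p n) - inner (q 0) (p 0)" for n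
  proof (induction n)
    case (Suc n)
    have "z (Suc (Suc (2 * n))) = (q (Suc n), p (Suc n))" using even[of "Suc n"] by simp
    with Suc show ?case
      by (simp add: even odd Jmat_def inner_diff_left inner_diff_right inner_commute)
  qed simp
  have zm: "z (2 * m) = z 0" using even[of m] even[of 0] closed by simp
  have mv: "2 * i < 2 * m" "z (Suc (2 * i)) \<noteq> z (2 * i)" using move by (auto simp: even odd)
  have body: "convex (Q \<times> T)" "interior (Q \<times> T) \<noteq> {}"
    using conv int by (auto simp: convex_Times interior_Times)
  note bounds = c_EHZ_polygon[of "Q \<times> T" "2 * m" z "2 * i", OF body zC zm mv zn]
  from bounds closed show "c_EHZ (Q \<times> T) \<ge> 0" "c_EHZ (Q \<times> T) \<le> (\<Sum>j<m. inner (q (Suc j) - q j) (p j))"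
    by (simp_all add: sum)
qed

section \<open>Largest homothets in a convex body\<close>


text \<open>Lagrange duality for maximizing \<open>l\<close> under three membership constraints:
  stationarity in \<open>v\<close> and in \<open>l\<close> gives the last two equations. The vectors
  may be dependent: \<open>b\<close> = 0 occurs for parallelograms, and \<open>a\<close> =
  \<open>b\<close> yields a longest chord.\<close>

lemma maximal_homothet:
  fixes T :: "'a::euclidean_space set"
  assumes T: "convex_body T" and a: "a \<noteq> 0 \<or> b \<noteq> 0"
  obtains l v u1 u2 u3 where "l > 0" "v \<in> T" "v + l *\<^sub>R a \<in> T" "v + l *\<^sub>R b \<in> T"
    "\<And>y. y \<in> T \<Longrightarrow> inner u1 (y - v) \<le> 0"
    "\<And>y. y \<in> T \<Longrightarrow> inner u2 (y - (v + l *\<^sub>R a)) \<le> 0"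
    "\<And>y. y \<in> T \<Longrightarrow> inner u3 (y - (v + l *\<^sub>R b)) \<le> 0"
    "u1 + u2 + u3 = 0" "inner u2 a + inner u3 b = 1"
proof -
  have compT: "compact T" and convT: "convex T" and intT: "interior T \<noteq> {}"
    using T by (auto simp: convex_body_def)
  define S where "S = (T \<times> {0..}) \<inter> (\<lambda>(v,l). v + l *\<^sub>R a) -` T \<inter> (\<lambda>(v,l). v + l *\<^sub>R b) -` T"
  have closedT: "closed T" using compT compact_imp_closed by blast
  have clS: "closed S" unfolding S_def
    by (intro closed_Int closed_Times closedT closed_vimage continuous_intros closed_atLeast)
      (auto simp: case_prod_unfold intro!: continuous_intros)
  obtain B where B: "\<And>y. y \<in> T \<Longrightarrow> norm y \<le> B"
    using compact_imp_bounded[OF compT] by (auto simp: bounded_iff)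
  have "bounded S"
  proof -
    have "l \<le> 2 * B / norm c" if "l \<ge> 0" "v \<in> T" "v + l *\<^sub>R c \<in> T" "c \<noteq> 0" for l v c
    proof -
      have "l * norm c = norm ((v + l *\<^sub>R c) - v)" using that by simp
      also have "\<dots> \<le> norm (v + l *\<^sub>R c) + norm v" by (rule norm_triangle_ineq4)
      also have "\<dots> \<le> 2 * B" using B[OF that(2)] B[OF that(3)] by simp
      finally show ?thesis using that by (simp add: field_simps)
    qed
    then have "S \<subseteq> T \<times> {0..max (2 * B / norm a) (2 * B / norm b)}"
      using a by (auto simp: S_def le_max_iff_disj)
    then show ?thesis
      using bounded_Times[OF compact_imp_bounded[OF compT]] bounded_closed_interval bounded_subset by blast
  qed
  with clS have "compact S" by (simp add: compact_eq_bounded_closed)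
  obtain c r where r: "r > 0" "ball c r \<subseteq> T"
    using intT by (auto simp: mem_interior)
  define K where "K = norm a + norm b + 1"
  have K: "K > 0" "norm a < K" "norm b < K" by (auto simp: K_def add_nonneg_pos)
  \<comment> \<open>Applied at ratio 0 this shows that the maximal ratio is positive; applied at
    ratios from \<open>l\<close> on it contradicts maximality and keeps \<open>I\<close> and
    \<open>H\<close> apart.\<close>
  have grow: "\<exists>\<delta>>0. \<forall>w \<in> {a, b}. x + (l + \<delta>) *\<^sub>R w \<in> T"
    if x: "x + l *\<^sub>R a \<in> interior T" "x + l *\<^sub>R b \<in> interior T" for x l
  proof -
    obtain s1 where s1: "s1 > 0" "ball (x + l *\<^sub>R a) s1 \<subseteq> T" using x by (auto simp: mem_interior)
    obtain s2 where s2: "s2 > 0" "ball (x + l *\<^sub>R b) s2 \<subseteq> T" using x by (auto simp: mem_interior)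
    define \<delta> where "\<delta> = min s1 s2 / K"
    have \<delta>: "\<delta> > 0" "\<delta> * K \<le> s1" "\<delta> * K \<le> s2" using s1 s2 K by (auto simp: \<delta>_def)
    have "x + (l + \<delta>) *\<^sub>R a \<in> ball (x + l *\<^sub>R a) s1"
    proof -
      have "\<delta> * norm a < s1"
        using \<delta>(2) mult_strict_left_mono[OF K(2) \<delta>(1)] by linarith
      then show ?thesis using \<delta>(1) by (simp add: dist_norm algebra_simps)
    qed
    moreover have "x + (l + \<delta>) *\<^sub>R b \<in> ball (x + l *\<^sub>R b) s2"
    proof -
      have "\<delta> * norm b < s2"
        using \<delta>(3) mult_strict_left_mono[OF K(3) \<delta>(1)] by linarith
      then show ?thesis using \<delta>(1) by (simp add: dist_norm algebra_simps)
    qed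
    ultimately show ?thesis using s1 s2 \<delta>(1) by blast
  qed
  have cint: "c \<in> interior T" using r by (auto simp: mem_interior)
  obtain \<delta>0 where \<delta>0: "\<delta>0 > 0" "(c, \<delta>0) \<in> S"
    using grow[of c 0] cint interior_subset by (fastforce simp: S_def)
  have "\<exists>m\<in>S. \<forall>n\<in>S. snd n \<le> snd m"
    using \<open>compact S\<close> \<delta>0 by (intro continuous_attains_sup continuous_intros) auto
  then obtain v l where vl: "(v, l) \<in> S" and max: "\<And>v' l'. (v', l') \<in> S \<Longrightarrow> l' \<le> l"
    by fastforce
  have l: "l > 0" using max[OF \<delta>0(2)] \<delta>0(1) by simp
  have vT: "v \<in> T" "v + l *\<^sub>R a \<in> T" "v + l *\<^sub>R b \<in> T" using vl by (auto simp: S_def)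
  \<comment> \<open>Separation takes place in the threefold product. \<open>H\<close> holds the
    corner triples of all homothets of ratio at least \<open>l\<close>; by maximality none of them
    is interior in all three places. The components of the separating functional are the
    multipliers.\<close>
  define I where "I = interior T \<times> interior T \<times> interior T"
  define H where "H = {(x, x + k *\<^sub>R a, x + k *\<^sub>R b) | x k. k \<ge> l}"
  have "I \<inter> H = {}"
  proof (rule ccontr)
    assume "I \<inter> H \<noteq> {}"
    then obtain x k where x: "x \<in> interior T" "x + k *\<^sub>R a \<in> interior T" "x + k *\<^sub>R b \<in> interior T" "k \<ge> l"
      by (auto simp: I_def H_def)
    from grow[OF x(2,3)] obtain \<delta> where "\<delta> > 0" "x + (k + \<delta>) *\<^sub>R a \<in> T" "x + (k + \<delta>) *\<^sub>R b \<in> T"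
      by auto
    with x l interior_subset[of T] have "(x, k + \<delta>) \<in> S" by (auto simp: S_def)
    from max[OF this] x \<open>\<delta> > 0\<close> show False by simp
  qed
  moreover have "convex I" unfolding I_def by (intro convex_Times convex_interior convT)
  moreover have "convex H"
  proof -
    have "H = (\<lambda>(x, k). (x, x + k *\<^sub>R a, x + k *\<^sub>R b)) ` (UNIV \<times> {l..})"
      by (auto simp: H_def image_iff)
    moreover have "linear (\<lambda>(x, k). (x, x + k *\<^sub>R a, x + k *\<^sub>R b))"
      by (intro linearI) (auto simp: algebra_simps)
    ultimately show ?thesis
      by (simp add: convex_linear_image convex_Times)
  qed
  moreover have "I \<noteq> {}" "H \<noteq> {}" using intT by (auto simp: I_def H_def)
  ultimately obtain U \<beta> where U: "U \<noteq> 0" "\<And>x. x \<in> I \<Longrightarrow> inner U x \<le> \<beta>" "\<And>x. x \<in> H \<Longrightarrow> inner U x \<ge> \<beta>"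
    using separating_hyperplane_sets[of I H] by blast
  obtain u1 u2 u3 where u: "U = (u1, u2, u3)" by (cases U) auto
  have UT: "inner u1 x + inner u2 y + inner u3 z \<le> \<beta>" if "x \<in> T" "y \<in> T" "z \<in> T" for x y z
  proof -
    have "closure I \<subseteq> {x. inner U x \<le> \<beta>}"
      using U(2) by (intro closure_minimal closed_halfspace_le) auto
    moreover have "closure I = T \<times> T \<times> T"
      unfolding I_def closure_Times convex_closure_interior[OF convT intT] closure_closed[OF closedT] ..
    ultimately have "(x, y, z) \<in> {x. inner U x \<le> \<beta>}" using that by blast
    then show ?thesis by (simp add: u add.assoc)
  qed
  define \<kappa> where "\<kappa> = inner u2 a + inner u3 b"
  have UH: "\<beta> \<le> inner (u1 + u2 + u3) x + k * \<kappa>" if "k \<ge> l" for x k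
    using U(3)[of "(x, x + k *\<^sub>R a, x + k *\<^sub>R b)"] that
    by (auto simp: H_def u \<kappa>_def algebra_simps)
  have sum0: "u1 + u2 + u3 = 0"
  proof (rule ccontr)
    define w where "w = u1 + u2 + u3"
    assume "u1 + u2 + u3 \<noteq> 0"
    then have w: "inner w w > 0" by (simp add: w_def)
    \<comment> \<open>A linear form bounded below on the whole space vanishes: this multiple of
      \<open>w\<close> would push the value below the bound by 1.\<close>
    have "\<beta> \<le> inner w (- ((l * \<kappa> - \<beta> + 1) / inner w w) *\<^sub>R w) + l * \<kappa>"
      unfolding w_def by (rule UH) simp
    also have "\<dots> = \<beta> - 1" using w by simp
    finally show False by simp
  qed
  then have u1: "u1 = - u2 - u3" by (metis add_diff_cancel_right' diff_0 add.commute diff_diff_eq)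
  have "\<beta> \<le> l * \<kappa>" using UH[of l 0] by simp
  moreover have val: "inner u1 v + inner u2 (v + l *\<^sub>R a) + inner u3 (v + l *\<^sub>R b) = l * \<kappa>"
    by (simp add: u1 \<kappa>_def algebra_simps)
  ultimately have \<beta>: "\<beta> = l * \<kappa>" using UT[OF vT] by simp
  \<comment> \<open>On the diagonal triple with entries \<open>c\<close> the functional is 0, since
    the multipliers add up to zero. A small shift along \<open>U\<close> keeps all three entries in
    \<open>T\<close> and makes the value positive.\<close>
  have "\<beta> > 0"
  proof -
    define \<epsilon> where "\<epsilon> = r / 2 / norm U"
    have \<epsilon>: "\<epsilon> > 0" using r U(1) by (simp add: \<epsilon>_def)
    have "c + \<epsilon> *\<^sub>R w \<in> T" if "norm w \<le> norm U" for w
    proof -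
      have "\<epsilon> * norm w \<le> \<epsilon> * norm U" using \<epsilon> that by simp
      also have "\<dots> = r / 2" using U(1) by (simp add: \<epsilon>_def)
      finally have "norm (\<epsilon> *\<^sub>R w) < r" using \<epsilon> r by simp
      then show ?thesis using r(2) by (auto simp: dist_norm subset_iff)
    qed
    moreover have "norm u1 \<le> norm U" "norm (u2, u3) \<le> norm U" "norm u2 \<le> norm (u2, u3)" "norm u3 \<le> norm (u2, u3)"
      using norm_fst_le[of u1 "(u2,u3)"] norm_snd_le[of "(u2,u3)" u1] norm_fst_le[of u2 u3] norm_snd_le[of u3 u2]
      by (simp_all add: u)
    ultimately have "inner u1 (c + \<epsilon> *\<^sub>R u1) + inner u2 (c + \<epsilon> *\<^sub>R u2) + inner u3 (c + \<epsilon> *\<^sub>R u3) \<le> \<beta>"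
      by (intro UT) auto
    moreover have "inner u1 c + inner u2 c + inner u3 c = 0"
      by (simp add: u1 inner_diff_left)
    ultimately have "\<epsilon> * inner U U \<le> \<beta>"
      by (simp add: u inner_add_right algebra_simps)
    moreover have "\<epsilon> * inner U U > 0" using \<epsilon> U(1) by simp
    ultimately show ?thesis by linarith
  qed
  with \<beta> l have \<kappa>: "\<kappa> > 0" by (simp add: zero_less_mult_iff)
  show thesis
  proof (rule that[of l v "(1/\<kappa>) *\<^sub>R u1" "(1/\<kappa>) *\<^sub>R u2" "(1/\<kappa>) *\<^sub>R u3"])
    show "(1/\<kappa>) *\<^sub>R u1 + (1/\<kappa>) *\<^sub>R u2 + (1/\<kappa>) *\<^sub>R u3 = 0"
      unfolding scaleR_add_right[symmetric] sum0 by simp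
    show "inner ((1/\<kappa>) *\<^sub>R u2) a + inner ((1/\<kappa>) *\<^sub>R u3) b = 1"
      using \<kappa> unfolding inner_scaleR_left distrib_left[symmetric] \<kappa>_def[symmetric] by simp
    fix y assume y: "y \<in> T"
    have "inner u1 (y - v) \<le> 0" "inner u2 (y - (v + l *\<^sub>R a)) \<le> 0" "inner u3 (y - (v + l *\<^sub>R b)) \<le> 0"
      using UT[OF y vT(2,3)] UT[OF vT(1) y vT(3)] UT[OF vT(1,2) y] val \<beta>
      by (simp_all add: inner_diff_right)
    then show "inner ((1/\<kappa>) *\<^sub>R u1) (y - v) \<le> 0" "inner ((1/\<kappa>) *\<^sub>R u2) (y - (v + l *\<^sub>R a)) \<le> 0"
      "inner ((1/\<kappa>) *\<^sub>R u3) (y - (v + l *\<^sub>R b)) \<le> 0"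
      using \<kappa> by (simp_all add: divide_nonpos_pos)
  qed (use l vT in auto)
qed

section \<open>Areas of planar convex sets\<close>


definition cross2 :: "R2 \<Rightarrow> R2 \<Rightarrow> real" where
  "cross2 x y = x $ 1 * y $ 2 - x $ 2 * y $ 1"

text \<open>The Gram determinant identity. It reads areas off from the coordinates
  \<open>inner x e\<close> and \<open>inner x f\<close> alone, with \<open>cross2 e f\<close> as
  conversion factor.\<close>

lemma cross2_mult_cross2:
  "cross2 x y * cross2 e f = inner x e * inner y f - inner x f * inner y e"
  by (simp add: cross2_def inner_vec_def sum_2 algebra_simps)

lemma measure_triangle:
  "measure lebesgue (convex hull {A, B, C}) = \<bar>cross2 (B - A) (C - A)\<bar> / 2"
proof -
  have "measure lebesgue (convex hull {A, B, C}) = measure lborel (convex hull {A, B, C})"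
    by (intro measure_completion)
      (simp add: borel_compact compact_convex_hull finite_imp_compact)
  then show ?thesis
    by (simp add: content_triangle cross2_def abs_minus_commute algebra_simps)
qed

lemma lmeasurable_triangle: "convex hull {A, B, C :: R2} \<in> lmeasurable"
  by (intro lmeasurable_compact compact_convex_hull finite_imp_compact) simp

text \<open>The line through \<open>B\<close> and \<open>C\<close> separates \<open>A\<close> from
  \<open>D\<close>, so the two triangles over the diagonal meet in a null set and both lie in
  \<open>S\<close>. The weak inequality admits flat triangles, which arise from chords of length
  zero.\<close>

lemma quadrilateral_measure_le:
  assumes S: "convex S" "S \<in> lmeasurable" and mem: "A \<in> S" "B \<in> S" "C \<in> S" "D \<in> S"
    and opposite: "cross2 (C - B) (A - B) * cross2 (C - B) (D - B) \<le> 0"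
  shows "(\<bar>cross2 (C - B) (A - B)\<bar> + \<bar>cross2 (C - B) (D - B)\<bar>) / 2 \<le> measure lebesgue S"
proof (cases "B = C")
  case False
  \<comment> \<open>The diagonal turned by a right angle, so that signs of cross products become
    halfplane conditions.\<close>
  define n :: R2 where "n = vector [- (C - B) $ 2, (C - B) $ 1]"
  have n: "inner n x = cross2 (C - B) x" for x
    by (simp add: n_def cross2_def inner_vec_def sum_2 algebra_simps)
  have "n \<noteq> 0" using False by (auto simp: n_def vec_eq_iff forall_2)
  have nBC: "inner n B = inner n C"
    unfolding n by (simp add: cross2_def algebra_simps)
  let ?X = "convex hull {B, C, A}" and ?Y = "convex hull {B, C, D}"
  have side: "convex hull {B, C, Z} \<subseteq> {x. \<sigma> * inner n x \<ge> \<sigma> * inner n B}" if "\<sigma> * inner n (Z - B) \<ge> 0" for Z \<sigma>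
  proof (rule hull_minimal)
    show "{B, C, Z} \<subseteq> {x. \<sigma> * inner n x \<ge> \<sigma> * inner n B}"
      using that nBC by (auto simp: inner_diff_right algebra_simps)
    show "convex {x. \<sigma> * inner n x \<ge> \<sigma> * inner n B}"
      using convex_halfspace_ge[of "\<sigma> * inner n B" "\<sigma> *\<^sub>R n"] by simp
  qed
  have "?X \<inter> ?Y \<subseteq> {x. inner n x = inner n B}"
  proof -
    have "inner n (A - B) \<ge> 0 \<and> inner n (D - B) \<le> 0 \<or> inner n (A - B) \<le> 0 \<and> inner n (D - B) \<ge> 0"
      using opposite unfolding n[symmetric] mult_le_0_iff .
    then show ?thesis
      using side[of 1 A] side[of 1 D] side[of "-1" A] side[of "-1" D] by fastforce
  qed
  then have "negligible (?X \<inter> ?Y)"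
    using negligible_hyperplane[of n "inner n B"] \<open>n \<noteq> 0\<close> negligible_subset by blast
  then have "measure lebesgue (?X \<union> ?Y) = measure lebesgue ?X + measure lebesgue ?Y"
    using measure_Un3[OF lmeasurable_triangle[of B C A] lmeasurable_triangle[of B C D]]
    by (simp add: negligible_imp_measure0)
  moreover have "?X \<subseteq> S" "?Y \<subseteq> S" using S mem by (simp_all add: hull_minimal)
  then have "measure lebesgue (?X \<union> ?Y) \<le> measure lebesgue S"
    using S(2) lmeasurable_triangle
    by (intro measure_mono_fmeasurable fmeasurableD fmeasurable.Un) auto
  ultimately show ?thesis unfolding measure_triangle by (simp add: add_divide_distrib)
qed (simp add: cross2_def)

text \<open>In the basis dual to \<open>e\<close> and \<open>f\<close> a point has abscissa
  \<open>inner z e\<close> and ordinate \<open>inner z f\<close>, so this is a vertical segment with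
  both ends in \<open>S\<close>. It need not be maximal, and length 0 just records a point of
  \<open>S\<close> at that abscissa.\<close>

definition chord :: "R2 set \<Rightarrow> R2 \<Rightarrow> R2 \<Rightarrow> real \<Rightarrow> real \<Rightarrow> bool" where
  "chord S e f x l \<longleftrightarrow> (\<exists>A\<in>S. \<exists>B\<in>S. inner A e = x \<and> inner B e = x \<and> inner (B - A) f = l)"

definition slab_measure :: "R2 set \<Rightarrow> R2 \<Rightarrow> real \<Rightarrow> real \<Rightarrow> real" where
  "slab_measure S e x y = measure lebesgue (S \<inter> {z. x \<le> inner z e \<and> inner z e \<le> y})"

lemma slab_eq: "{z. x \<le> inner z e \<and> inner z e \<le> y} = {z. inner e z \<ge> x} \<inter> {z. inner e z \<le> y}"
  by (auto simp: inner_commute)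

lemma slab_lmeasurable:
  assumes "compact S"
  shows "S \<inter> {z. x \<le> inner z e \<and> inner z e \<le> y} \<in> lmeasurable"
  unfolding slab_eq
  using assms by (intro lmeasurable_compact compact_Int_closed closed_Int closed_halfspace_ge closed_halfspace_le)

lemma slab_convex:
  assumes "convex S"
  shows "convex (S \<inter> {z. x \<le> inner z e \<and> inner z e \<le> y})"
  unfolding slab_eq using assms by (intro convex_Int convex_halfspace_ge convex_halfspace_le)

lemma slab_measure_le:
  assumes "compact S"
  shows "slab_measure S e x y \<le> measure lebesgue S"
  unfolding slab_measure_def
  using slab_lmeasurable[OF assms, of x e y] lmeasurable_compact[OF assms]
  by (intro measure_mono_fmeasurable fmeasurableD) auto

lemma slab_measure_add:
  assumes S: "compact S" and e: "e \<noteq> 0" and xyz: "x \<le> y" "y \<le> z"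
  shows "slab_measure S e x y + slab_measure S e y z \<le> slab_measure S e x z"
proof -
  let ?X = "S \<inter> {w. x \<le> inner w e \<and> inner w e \<le> y}" and ?Y = "S \<inter> {w. y \<le> inner w e \<and> inner w e \<le> z}"
  have "?X \<inter> ?Y \<subseteq> {w. inner e w = y}" by (auto simp: inner_commute)
  then have "negligible (?X \<inter> ?Y)"
    using negligible_hyperplane[of e y] e negligible_subset by blast
  then have "measure lebesgue ?X + measure lebesgue ?Y = measure lebesgue (?X \<union> ?Y)"
    using measure_Un3[OF slab_lmeasurable[OF S] slab_lmeasurable[OF S], of x e y y e z]
    by (simp add: negligible_imp_measure0)
  also have "?X \<union> ?Y = S \<inter> {w. x \<le> inner w e \<and> inner w e \<le> z}" using xyz by auto
  finally show ?thesis by (simp add: slab_measure_def)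
qed

text \<open>The ends of the two chords are the corners of a trapezoid in the slab, cut along the
  diagonal from \<open>B\<close> to \<open>C\<close>. The factor in front of the measure converts it
  to area in dual coordinates.\<close>

lemma slab_measure_chords:
  assumes S: "compact S" "convex S" and xy: "x \<le> y"
    and chords: "chord S e f x l" "chord S e f y m" and lm: "0 \<le> l" "0 \<le> m"
  shows "(y - x) * (l + m) / 2 \<le> \<bar>cross2 e f\<bar> * slab_measure S e x y"
proof -
  obtain A B where AB: "A \<in> S" "B \<in> S" "inner A e = x" "inner B e = x" "inner (B - A) f = l"
    using chords by (auto simp: chord_def)
  obtain C D where CD: "C \<in> S" "D \<in> S" "inner C e = y" "inner D e = y" "inner (D - C) f = m"
    using chords by (auto simp: chord_def)
  let ?S = "S \<inter> {z. x \<le> inner z e \<and> inner z e \<le> y}"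
  have eq1: "cross2 (C - B) (A - B) * cross2 e f = - ((y - x) * l)"
    unfolding cross2_mult_cross2 using AB CD by (simp add: inner_diff_left algebra_simps)
  have eq2: "cross2 (C - B) (D - B) * cross2 e f = (y - x) * m"
  proof -
    have "inner (D - B) f = inner (C - B) f + m" using CD(5) by (simp add: inner_diff_left)
    then show ?thesis
      unfolding cross2_mult_cross2 using AB CD by (simp add: inner_diff_left[of _ _ e] algebra_simps)
  qed
  show ?thesis
  proof (cases "cross2 e f = 0")
    case True
    with eq1 eq2 show ?thesis by (auto simp: distrib_left)
  next
    case False
    then have square_pos: "0 < cross2 e f * cross2 e f"
      using not_real_square_gt_zero by blast
    have "(cross2 (C - B) (A - B) * cross2 (C - B) (D - B)) * (cross2 e f * cross2 e f)
      = (- ((y - x) * l)) * ((y - x) * m)"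
      unfolding eq1[symmetric] eq2[symmetric] by (simp add: algebra_simps)
    also have "\<dots> \<le> 0"
      using xy lm by (simp add: mult_nonneg_nonneg)
    finally have "cross2 (C - B) (A - B) * cross2 (C - B) (D - B) \<le> 0"
      using mult_pos_pos[OF _ square_pos] by (meson not_le)
    then have "(\<bar>cross2 (C - B) (A - B)\<bar> + \<bar>cross2 (C - B) (D - B)\<bar>) / 2 \<le> slab_measure S e x y"
      unfolding slab_measure_def
      using AB CD xy
      by (intro quadrilateral_measure_le slab_convex slab_lmeasurable S) auto
    from mult_left_mono[OF this abs_ge_zero[of "cross2 e f"]]
    have "(\<bar>cross2 (C - B) (A - B) * cross2 e f\<bar> + \<bar>cross2 (C - B) (D - B) * cross2 e f\<bar>) / 2
      \<le> \<bar>cross2 e f\<bar> * slab_measure S e x y"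
      by (simp add: abs_mult algebra_simps)
    then show ?thesis
      unfolding eq1 eq2 using xy lm by (simp add: distrib_left)
  qed
qed

text \<open>Think of \<open>M\<close> as the area under a concave profile of chord lengths. If both triangles
  lie in the slab between \<open>x1\<close> and \<open>x2\<close> the trapezoidal bound suffices; otherwise the width
  \<open>W = x1 - x2 + 2 * c\<close> is compared with \<open>2 * c / (2 - \<kappa>)\<close>, the extremal case.\<close>

lemma area_of_chords:
  assumes S: "compact S" "convex S" and e: "e \<noteq> 0" and \<kappa>: "0 \<le> \<kappa>" "\<kappa> \<le> 1" and c: "0 < c"
    and c0: "chord S e f x0 c"
    and c1: "chord S e f x1 (c * \<kappa>)" "chord S e f (x1 + c) 0"
    and c2: "chord S e f x2 (c * \<kappa>)" "chord S e f (x2 - c) 0"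
  shows "c\<^sup>2 \<le> (2 - \<kappa>) * (\<bar>cross2 e f\<bar> * measure lebesgue S)"
proof -
  define G where "G x y = \<bar>cross2 e f\<bar> * slab_measure S e x y" for x y
  define M where "M = \<bar>cross2 e f\<bar> * measure lebesgue S"
  have GM: "G x y \<le> M" for x y
    unfolding G_def M_def by (intro mult_left_mono slab_measure_le S) simp
  have add: "G x y + G y z \<le> G x z" if "x \<le> y" "y \<le> z" for x y z
    using mult_left_mono[OF slab_measure_add[OF S(1) e that] abs_ge_zero[of "cross2 e f"]]
    by (simp add: G_def distrib_left)
  have tr: "(y - x) * (l + m) / 2 \<le> G x y"
    if "chord S e f x l" "chord S e f y m" "x \<le> y" "0 \<le> l" "0 \<le> m" for x y l m
    unfolding G_def using slab_measure_chords[OF S that(3,1,2,4,5)] .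
  have ck: "0 \<le> c * \<kappa>" using c \<kappa> by simp
  \<comment> \<open>The abscissas of the two apexes: \<open>b\<close> lies to the right of the side
    at \<open>x1\<close>, and \<open>a\<close> to the left of the side at \<open>x2\<close>.\<close>
  define a b where "a = x2 - c" and "b = x1 + c"
  have pa: "chord S e f a 0" and pb: "chord S e f b 0" using c1 c2 by (simp_all add: a_def b_def)
  \<comment> \<open>Such a slab is enough because (2 - \<kappa>) (1 + \<kappa>) = 2 + \<kappa> (1 -
    \<kappa>) is at least 2.\<close>
  have by_slab: ?thesis if "c * (c + c * \<kappa>) / 2 \<le> M"
  proof -
    have "c\<^sup>2 * 2 \<le> c\<^sup>2 * (2 + \<kappa> * (1 - \<kappa>))"
      using \<kappa> by (intro mult_left_mono) auto
    also have "\<dots> = (2 - \<kappa>) * (c * (c + c * \<kappa>))" by (simp add: power2_eq_square algebra_simps)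
    also have "\<dots> \<le> (2 - \<kappa>) * (2 * M)" using \<kappa> that by (intro mult_left_mono) auto
    finally show ?thesis by (simp add: M_def)
  qed
  have wide: "c * (c + c * \<kappa>) / 2 \<le> w * (c + c * \<kappa>) / 2" if "c \<le> w" for w
    using that ck c by (intro divide_right_mono mult_right_mono) auto
  show ?thesis
  proof (cases "x1 \<le> x2 - c")
    case True
    have "(x2 - x1) * (c + c * \<kappa>) / 2 \<le> M"
    proof -
      consider "x0 \<le> x1" | "x1 \<le> x0" "x0 \<le> x2" | "x2 \<le> x0" by linarith
      then show ?thesis
      proof cases
        case 1
        have "(x2 - x1) * (c + c * \<kappa>) / 2 \<le> (x2 - x0) * (c + c * \<kappa>) / 2"
          using 1 ck c by (intro divide_right_mono mult_right_mono) auto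
        also have "\<dots> \<le> M"
          using tr[OF c0 c2(1)] GM[of x0 x2] 1 True c ck by linarith
        finally show ?thesis .
      next
        case 2
        then show ?thesis
          using tr[OF c1(1) c0] tr[OF c0 c2(1)] add[of x1 x0 x2] GM[of x1 x2] c ck
          by (simp add: algebra_simps)
      next
        case 3
        have "(x2 - x1) * (c + c * \<kappa>) / 2 \<le> (x0 - x1) * (c * \<kappa> + c) / 2"
          using 3 ck c by (simp add: add.commute[of c] mult_right_mono)
        also have "\<dots> \<le> M"
          using tr[OF c1(1) c0] GM[of x1 x0] 3 True c ck by linarith
        finally show ?thesis .
      qed
    qed
    with wide[of "x2 - x1"] True show ?thesis by (intro by_slab) linarith
  next
    case False
    define W where "W = b - a"
    have W: "W > c" "x1 = a + (W - c)" "x2 = a + c" "b = a + W"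
      using False by (auto simp: W_def a_def b_def)
    \<comment> \<open>The chord at \<open>x0\<close> and the two apexes span triangles of total
      width \<open>W\<close>, or a single one at least that wide if \<open>x0\<close> lies
      outside.\<close>
    have peak: "W * c / 2 \<le> M"
    proof -
      consider "x0 \<le> a" | "a \<le> x0" "x0 \<le> b" | "b \<le> x0" by linarith
      then show ?thesis
      proof cases
        case 1
        have "W * c / 2 \<le> (b - x0) * (c + 0) / 2" using 1 c by (simp add: W_def mult_right_mono)
        also have "\<dots> \<le> M" using tr[OF c0 pb] GM[of x0 b] 1 W c by linarith
        finally show ?thesis .
      next
        case 2
        then show ?thesis
          using tr[OF pa c0] tr[OF c0 pb] add[of a x0 b] GM[of a b] c
          by (simp add: W_def algebra_simps)
      next
        case 3
        have "W * c / 2 \<le> (x0 - a) * (0 + c) / 2" using 3 c by (simp add: W_def mult_right_mono)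
        also have "\<dots> \<le> M" using tr[OF pa c0] GM[of a x0] 3 W c by linarith
        finally show ?thesis .
      qed
    qed
    show ?thesis
    proof (cases "W * (2 - \<kappa>) \<ge> 2 * c")
      case True
      have "c\<^sup>2 \<le> c * (W * (2 - \<kappa>)) / 2"
        using mult_left_mono[OF True, of c] c by (simp add: power2_eq_square)
      also have "\<dots> = (2 - \<kappa>) * (W * c / 2)" by simp
      also have "\<dots> \<le> (2 - \<kappa>) * M" using \<kappa> peak by (intro mult_left_mono) auto
      finally show ?thesis by (simp add: M_def)
    next
      case narrow: False
      have W2: "W < 2 * c"
      proof -
        have "W * 1 \<le> W * (2 - \<kappa>)" using \<kappa> W c by (intro mult_left_mono) auto
        with narrow show ?thesis by linarith
      qed
      have ord: "a \<le> x1" "x1 \<le> x2" "x2 \<le> b" using W W2 by auto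
      have cW: "0 \<le> (W - c) * (c * \<kappa>)" using W ck by simp
      consider "b \<le> x0" | "x2 \<le> x0" "x0 \<le> b" | "x1 \<le> x0" "x0 \<le> x2" | "a \<le> x0" "x0 \<le> x1" | "x0 \<le> a"
        by linarith
      then show ?thesis
      proof cases
        case 1
        have "(x0 - x1) * (c * \<kappa> + c) / 2 \<le> M"
          using tr[OF c1(1) c0] GM[of x1 x0] 1 ord c ck by linarith
        with wide[of "x0 - x1"] 1 show ?thesis by (intro by_slab) (simp add: b_def add.commute)
      next
        case 2
        \<comment> \<open>Compared with a slab from \<open>x1\<close> to \<open>b\<close> with
          chords \<open>c\<close> and \<open>c * \<kappa>\<close>, a triangle of width
          \<open>b - x0\<close> is missing on the right. The triangle of width \<open>W - c\<close>
          between \<open>a\<close> and \<open>x1\<close> makes up for it.\<close>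
        have "0 \<le> (W - c - (b - x0)) * (c * \<kappa>)" using 2 ck W by simp
        moreover have "(x1 - a) * (0 + c * \<kappa>) / 2 + (x0 - x1) * (c * \<kappa> + c) / 2 + (b - x0) * (c + 0) / 2 \<le> M"
          using tr[OF pa c1(1)] tr[OF c1(1) c0] tr[OF c0 pb] add[of a x1 x0] add[of a x0 b] GM[of a b] 2 ord c ck
          by linarith
        ultimately show ?thesis by (intro by_slab) (simp add: W algebra_simps add_divide_distrib diff_divide_distrib)
      next
        case 3
        \<comment> \<open>The only case where the slab bound can fail. The four pieces add up to a
          nonincreasing function of \<open>W\<close>, and the upper bound \<open>narrow\<close> on
          \<open>W\<close> leaves exactly c^2 / (2 - \<kappa>).\<close>
        have "(x1 - a) * (0 + c * \<kappa>) / 2 + (x0 - x1) * (c * \<kappa> + c) / 2 + (x2 - x0) * (c + c * \<kappa>) / 2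
            + (b - x2) * (c * \<kappa> + 0) / 2 \<le> M"
          using tr[OF pa c1(1)] tr[OF c1(1) c0] tr[OF c0 c2(1)] tr[OF c2(1) pb]
            add[of a x1 x0] add[of a x0 x2] add[of a x2 b] GM[of a b] 3 ord c ck
          by linarith
        then have "c * (2 * c - W * (1 - \<kappa>)) / 2 \<le> M"
          by (simp add: W algebra_simps add_divide_distrib diff_divide_distrib)
        then have M: "(2 - \<kappa>) * (c * (2 * c - W * (1 - \<kappa>)) / 2) \<le> (2 - \<kappa>) * M"
          using \<kappa> by (intro mult_left_mono) auto
        have "(c * (1 - \<kappa>)) * (W * (2 - \<kappa>)) \<le> (c * (1 - \<kappa>)) * (2 * c)"
          using narrow c \<kappa> by (intro mult_left_mono) auto
        with M show ?thesis 
          by (simp add: M_def power2_eq_square algebra_simps add_divide_distrib diff_divide_distrib)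
      next
        case 4
        have "0 \<le> (W - c - (x0 - a)) * (c * \<kappa>)" using 4 ck W by simp
        moreover have "(x0 - a) * (0 + c) / 2 + (x2 - x0) * (c + c * \<kappa>) / 2 + (b - x2) * (c * \<kappa> + 0) / 2 \<le> M"
          using tr[OF pa c0] tr[OF c0 c2(1)] tr[OF c2(1) pb] add[of a x0 x2] add[of a x2 b] GM[of a b] 4 ord c ck
          by linarith
        ultimately show ?thesis by (intro by_slab) (simp add: W algebra_simps add_divide_distrib diff_divide_distrib)
      next
        case 5
        have "(x2 - x0) * (c + c * \<kappa>) / 2 \<le> M"
          using tr[OF c0 c2(1)] GM[of x0 x2] 5 ord c ck by linarith
        with wide[of "x2 - x0"] 5 show ?thesis by (intro by_slab) (simp add: a_def)
      qed
    qed
  qed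
qed

section \<open>Billiard trajectories in a trapezoid\<close>


definition trapezoid_region :: "R2 \<Rightarrow> R2 \<Rightarrow> R2 \<Rightarrow> real \<Rightarrow> R2 set" where
  "trapezoid_region a e f \<kappa> =
     {a + s *\<^sub>R e + t *\<^sub>R f | s t. 0 \<le> t \<and> t \<le> 1 \<and> 0 \<le> s \<and> s + \<kappa> * t \<le> 1}"

definition dual_basis :: "R2 \<Rightarrow> R2 \<Rightarrow> R2 \<Rightarrow> R2 \<Rightarrow> bool" where
  "dual_basis e f E F \<longleftrightarrow> inner E e = 1 \<and> inner E f = 0 \<and> inner F e = 0 \<and> inner F f = 1 \<and>
     (\<forall>x. x = inner x E *\<^sub>R e + inner x F *\<^sub>R f)"

lemma dual_basisD:
  assumes "dual_basis e f E F"
  shows "inner E e = 1" "inner E f = 0" "inner F e = 0" "inner F f = 1"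
    "inner e E = 1" "inner f E = 0" "inner e F = 0" "inner f F = 1"
    "x = inner x E *\<^sub>R e + inner x F *\<^sub>R f"
  using assms by (auto simp: dual_basis_def inner_commute)

lemma mem_trapezoid_region:
  assumes "dual_basis e f E F"
  shows "x \<in> trapezoid_region a e f \<kappa> \<longleftrightarrow>
    0 \<le> inner F (x - a) \<and> inner F (x - a) \<le> 1 \<and> 0 \<le> inner E (x - a) \<and>
    inner E (x - a) + \<kappa> * inner F (x - a) \<le> 1"
proof
  assume "x \<in> trapezoid_region a e f \<kappa>"
  then show "0 \<le> inner F (x - a) \<and> inner F (x - a) \<le> 1 \<and> 0 \<le> inner E (x - a) \<and>
    inner E (x - a) + \<kappa> * inner F (x - a) \<le> 1"
    using dual_basisD(1-4)[OF assms] by (auto simp: trapezoid_region_def inner_add_right)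
next
  have "x = a + inner E (x - a) *\<^sub>R e + inner F (x - a) *\<^sub>R f"
    using dual_basisD(9)[OF assms, of "x - a"] by (simp add: inner_commute algebra_simps)
  moreover assume "0 \<le> inner F (x - a) \<and> inner F (x - a) \<le> 1 \<and> 0 \<le> inner E (x - a) \<and>
    inner E (x - a) + \<kappa> * inner F (x - a) \<le> 1"
  ultimately show "x \<in> trapezoid_region a e f \<kappa>"
    unfolding trapezoid_region_def by blast
qed

lemma convex_trapezoid_region:
  assumes "dual_basis e f E F"
  shows "convex (trapezoid_region a e f \<kappa>)"
proof (rule convexI)
  fix x y :: R2 and u v :: real
  assume xy: "x \<in> trapezoid_region a e f \<kappa>" "y \<in> trapezoid_region a e f \<kappa>"
    and uv: "0 \<le> u" "0 \<le> v" "u + v = 1"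
  have eq: "inner G (u *\<^sub>R x + v *\<^sub>R y - a) = u * inner G (x - a) + v * inner G (y - a)" for G
  proof -
    have "inner G (u *\<^sub>R x + v *\<^sub>R y - (u + v) *\<^sub>R a) = u * inner G (x - a) + v * inner G (y - a)"
      by (simp add: inner_diff_right inner_add_right algebra_simps)
    with uv show ?thesis by simp
  qed
  have comb: "u * c + v * d \<le> 1" if "c \<le> 1" "d \<le> 1" for c d
    using convex_bound_le[OF that uv] .
  show "u *\<^sub>R x + v *\<^sub>R y \<in> trapezoid_region a e f \<kappa>"
    using xy uv comb[of "inner F (x - a)" "inner F (y - a)"]
      comb[of "inner E (x - a) + \<kappa> * inner F (x - a)" "inner E (y - a) + \<kappa> * inner F (y - a)"]
    unfolding mem_trapezoid_region[OF assms] eq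
    by (auto simp: distrib_left ac_simps)
qed

text \<open>The edges of the momentum triangle are multiples of \<open>E\<close>, - \<open>E\<close>
  - \<kappa> \<open>F\<close> and \<open>F\<close>: the inner normals of the left, the slanted and
  the bottom side of \<open>Q\<close>. For \<kappa> = 0 the last edge vanishes and two sides remain.
  The second alternative covers a polygon that is too tall for \<open>Q\<close>.\<close>

lemma three_bounce:
  assumes dual: "dual_basis e f E F" and \<kappa>: "0 \<le> \<kappa>" "\<kappa> \<le> 1" and T: "convex_body T"
    and Q: "Q = trapezoid_region a e f \<kappa>" "interior Q \<noteq> {}"
  obtains l v where "l > 0" "v \<in> T" "v + l *\<^sub>R E \<in> T" "v - (l * \<kappa>) *\<^sub>R F \<in> T"
    "0 \<le> c_EHZ (Q \<times> T) \<and> c_EHZ (Q \<times> T) \<le> l \<or>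
     (\<forall>A s. 0 \<le> s \<longrightarrow> A \<in> T \<longrightarrow> A + s *\<^sub>R F \<in> T \<longrightarrow> s < l)"
proof -
  have convT: "convex T" and intT: "interior T \<noteq> {}" using T by (auto simp: convex_body_def)
  note D = dual_basisD[OF dual]
  have "E \<noteq> 0" using D(1) by auto
  then obtain l v u1 u2 u3 where l: "l > 0"
    and pT': "v \<in> T" "v + l *\<^sub>R E \<in> T" "v + l *\<^sub>R (- \<kappa> *\<^sub>R F) \<in> T"
    and u': "\<And>y. y \<in> T \<Longrightarrow> inner u1 (y - v) \<le> 0"
      "\<And>y. y \<in> T \<Longrightarrow> inner u2 (y - (v + l *\<^sub>R E)) \<le> 0"
      "\<And>y. y \<in> T \<Longrightarrow> inner u3 (y - (v + l *\<^sub>R (- \<kappa> *\<^sub>R F))) \<le> 0"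
    and sum0: "u1 + u2 + u3 = 0" and norm': "inner u2 E + inner u3 (- \<kappa> *\<^sub>R F) = 1"
    using maximal_homothet[OF T, of E "- \<kappa> *\<^sub>R F"] by blast
  define p2 p3 where "p2 = v + l *\<^sub>R E" and "p3 = v - (l * \<kappa>) *\<^sub>R F"
  have pT: "v \<in> T" "p2 \<in> T" "p3 \<in> T" and u: "\<And>y. y \<in> T \<Longrightarrow> inner u1 (y - v) \<le> 0"
      "\<And>y. y \<in> T \<Longrightarrow> inner u2 (y - p2) \<le> 0" "\<And>y. y \<in> T \<Longrightarrow> inner u3 (y - p3) \<le> 0"
    using pT' u' by (simp_all add: p2_def p3_def)
  define x1 x2 x3 y1 y2 y3 where "x1 = inner u1 E" and "x2 = inner u2 E" and "x3 = inner u3 E"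
    and "y1 = inner u1 F" and "y2 = inner u2 F" and "y3 = inner u3 F"
  note xy_def = x1_def x2_def x3_def y1_def y2_def y3_def
  have x0: "x1 + x2 + x3 = 0" and y0: "y1 + y2 + y3 = 0"
    unfolding xy_def inner_add_left[symmetric] sum0 by simp_all
  have nrm: "x2 - \<kappa> * y3 = 1" using norm' by (simp add: xy_def)
  \<comment> \<open>Each supporting inequality is tested at the other two corners. The resulting
    signs keep the polygon between the lateral sides of \<open>Q\<close>, so that only its height
    can be a problem.\<close>
  have le: "l * x1 \<le> l * 0" "l * (- (\<kappa> * y1)) \<le> l * 0" "l * (- x2) \<le> l * 0" "l * (- x2 - \<kappa> * y2) \<le> l * 0"
    "l * (\<kappa> * y3) \<le> l * 0" "l * (x3 + \<kappa> * y3) \<le> l * 0"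
    using u(1)[OF pT(2)] u(1)[OF pT(3)] u(2)[OF pT(1)] u(2)[OF pT(3)] u(3)[OF pT(1)] u(3)[OF pT(2)]
    by (simp_all add: p2_def p3_def xy_def inner_diff_right inner_add_right algebra_simps)
  have ineq: "x1 \<le> 0" "0 \<le> \<kappa> * y1" "0 \<le> x2" "0 \<le> x2 + \<kappa> * y2" "\<kappa> * y3 \<le> 0" "x3 + \<kappa> * y3 \<le> 0"
    using le[unfolded mult_le_cancel_left_pos[OF l]] by simp_all
  have act: "inner u1 v + inner u2 p2 + inner u3 p3 = l"
  proof -
    have "inner u1 v + inner u2 p2 + inner u3 p3 = inner (u1 + u2 + u3) v + l * (x2 - \<kappa> * y3)"
      by (simp add: p2_def p3_def xy_def inner_add_left inner_add_right inner_diff_right algebra_simps)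
    with sum0 nrm show ?thesis by simp
  qed
  \<comment> \<open>Puts the lowest vertex at height 0. For positive \<kappa> this is the vertex on
    the bottom side; for \<kappa> = 0 there is no bounce on the bottom and the polygon may slide
    up.\<close>
  define t0 where "t0 = - min 0 (min y1 (y1 + y2))"
  have t0: "\<kappa> * t0 = 0"
  proof (cases "\<kappa> = 0")
    case False
    then have "\<kappa> > 0" using \<kappa> by simp
    then have "y1 \<ge> 0" "y3 \<le> 0" using ineq by (simp_all add: zero_le_mult_iff mult_le_0_iff)
    then show ?thesis using y0 by (simp add: t0_def)
  qed simp
  show thesis
  proof (rule that[OF l, of v])
    show "v \<in> T" "v + l *\<^sub>R E \<in> T" "v - (l * \<kappa>) *\<^sub>R F \<in> T" using pT by (simp_all add: p2_def p3_def)
    show "0 \<le> c_EHZ (Q \<times> T) \<and> c_EHZ (Q \<times> T) \<le> l \<or>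
     (\<forall>A s. 0 \<le> s \<longrightarrow> A \<in> T \<longrightarrow> A + s *\<^sub>R F \<in> T \<longrightarrow> s < l)"
    proof (cases "t0 \<le> 1 \<and> t0 + y1 \<le> 1 \<and> t0 + y1 + y2 \<le> 1")
      case True
      have tnn: "t0 \<ge> 0" "t0 + y1 \<ge> 0" "t0 + y1 + y2 \<ge> 0" by (auto simp: t0_def)
      define q1 q2 q3 where "q1 = a + (- x1) *\<^sub>R e + t0 *\<^sub>R f" and "q2 = a + (t0 + y1) *\<^sub>R f"
        and "q3 = a + x2 *\<^sub>R e + (t0 + y1 + y2) *\<^sub>R f"
      have coords: "inner E (q1 - a) = - x1" "inner F (q1 - a) = t0"
        "inner E (q2 - a) = 0" "inner F (q2 - a) = t0 + y1"
        "inner E (q3 - a) = x2" "inner F (q3 - a) = t0 + y1 + y2"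
        using D(1-4) by (simp_all add: q1_def q2_def q3_def inner_add_right inner_diff_right)
      have ky: "\<kappa> * y1 + \<kappa> * y2 + \<kappa> * y3 = 0" using y0 by (simp flip: distrib_left)
      have qQ: "q1 \<in> Q" "q2 \<in> Q" "q3 \<in> Q"
        unfolding Q(1) mem_trapezoid_region[OF dual] coords distrib_left t0
        using True tnn ineq x0 nrm ky by (intro conjI; linarith)+
      have ux: "u1 = x1 *\<^sub>R e + y1 *\<^sub>R f" "u2 = x2 *\<^sub>R e + y2 *\<^sub>R f" "u3 = x3 *\<^sub>R e + y3 *\<^sub>R f"
        unfolding xy_def by (rule D(9))+
      have x3: "x3 = - x1 - x2" and y3: "y3 = - y1 - y2" using x0 y0 by linarith+
      have dq: "q2 - q1 = u1" "q3 - q2 = u2" "q1 - q3 = u3"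
        unfolding ux x3 y3 q1_def q2_def q3_def by (simp_all add: algebra_simps)
      define q where "q j = [q1, q2, q3, q1] ! j" for j
      define p where "p j = [v, p2, p3, v] ! j" for j
      have q_simps: "q 0 = q1" "q (Suc 0) = q2" "q (Suc (Suc 0)) = q3" "q 3 = q1" "q (Suc (Suc (Suc 0))) = q1"
        and p_simps: "p 0 = v" "p (Suc 0) = p2" "p (Suc (Suc 0)) = p3" "p 3 = v" "p (Suc (Suc (Suc 0))) = v"
        by (simp_all add: q_def p_def)
      have less3: "j < 3 \<Longrightarrow> j = 0 \<or> j = Suc 0 \<or> j = Suc (Suc 0)" for j :: nat by linarith
      have le3: "j \<le> 3 \<Longrightarrow> j = 0 \<or> j = Suc 0 \<or> j = Suc (Suc 0) \<or> j = Suc (Suc (Suc 0))" for j :: nat by linarith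
      obtain i where i: "i < 3" "q (Suc i) \<noteq> q i"
      proof -
        have "\<not> (u1 = 0 \<and> u2 = 0)" using sum0 norm' by auto
        then have "q (Suc 0) \<noteq> q 0 \<or> q (Suc (Suc 0)) \<noteq> q (Suc 0)"
          using dq by (auto simp: q_simps)
        then show thesis
        proof
          assume "q (Suc 0) \<noteq> q 0"
          then show thesis by (intro that[of 0]) simp_all
        next
          assume "q (Suc (Suc 0)) \<noteq> q (Suc 0)"
          then show thesis by (intro that[of "Suc 0"]) simp_all
        qed
      qed
      have nq: "inner (p (Suc j) - p j) (x - q (Suc j)) \<ge> 0" if j: "j < 3" and x: "x \<in> Q" for j x
      proof -
        have x': "0 \<le> inner F (x - a)" "0 \<le> inner E (x - a)" "inner E (x - a) + \<kappa> * inner F (x - a) \<le> 1"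
          using x unfolding Q(1) mem_trapezoid_region[OF dual] by auto
        have split: "inner G (x - y) = inner G (x - a) - inner G (y - a)" for G y
          by (simp add: inner_diff_right)
        have "inner (p2 - v) (x - q2) = l * inner E (x - a)"
          by (simp add: p2_def split[of _ q2] coords)
        moreover have "inner (p3 - p2) (x - q3) = l * (1 - (inner E (x - a) + \<kappa> * inner F (x - a)))"
        proof -
          have "inner (p3 - p2) (x - q3) = l * ((inner E (q3 - a) + \<kappa> * inner F (q3 - a))
              - (inner E (x - a) + \<kappa> * inner F (x - a)))"
            by (simp add: p2_def p3_def inner_diff_left inner_add_left inner_diff_right algebra_simps)
          \<comment> \<open>The normalization of the multipliers places \<open>q3\<close> exactly on
            the slanted side.\<close>
          also have "inner E (q3 - a) + \<kappa> * inner F (q3 - a) = 1"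
            unfolding coords distrib_left t0 using ky nrm by linarith
          finally show ?thesis .
        qed
        moreover have "inner (v - p3) (x - q1) = l * (\<kappa> * inner F (x - a))"
        proof -
          have "inner (v - p3) (x - q1) = l * (\<kappa> * inner F (x - a) - \<kappa> * t0)"
            by (simp add: p3_def split[of _ q1] coords right_diff_distrib)
          then show ?thesis unfolding t0 by simp
        qed
        ultimately show ?thesis
          using less3[OF j] x' l \<kappa> by (auto simp: q_simps p_simps)
      qed
      have np: "inner (q (Suc j) - q j) (y - p j) \<le> 0" if j: "j < 3" and y: "y \<in> T" for j y
        using less3[OF j] u y by (auto simp: q_simps p_simps dq)
      have qm: "q j \<in> Q" "p j \<in> T" if "j \<le> 3" for j
        using le3[OF that] qQ pT by (auto simp: q_simps p_simps)
      have "(\<Sum>j<3. inner (q (Suc j) - q j) (p j)) = l"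
        using act by (simp add: eval_nat_numeral q_simps p_simps dq)
      then show ?thesis
        using c_EHZ_billiard[OF convex_trapezoid_region[OF dual, of a \<kappa>, folded Q(1)] convT Q(2) intT qm _ _ i np nq]
        by (simp add: q_simps p_simps)
    next
      case False
      have "s < l" if s: "0 \<le> s" "A \<in> T" "A + s *\<^sub>R F \<in> T" for A s
      proof -
        \<comment> \<open>Each multiplier is tested at the better end of the chord, which gains
          \<open>s\<close> times the positive part of its component along \<open>F\<close>.\<close>
        have best: "inner u A + s * max 0 (inner u F) \<le> inner u p" if "\<And>y. y \<in> T \<Longrightarrow> inner u (y - p) \<le> 0" for u p
          using that[OF s(2)] that[OF s(3)] by (auto simp: max_def inner_diff_right inner_add_right)
        have "inner u1 A + s * max 0 y1 + (inner u2 A + s * max 0 y2) + (inner u3 A + s * max 0 y3) \<le> l"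
          using best[of u1 v] best[of u2 p2] best[of u3 p3] u act by (simp add: xy_def)
        moreover have "inner u1 A + inner u2 A + inner u3 A = 0"
          unfolding inner_add_left[symmetric] sum0 by simp
        ultimately have "s * (max 0 y1 + max 0 y2 + max 0 y3) \<le> l"
          by (simp add: distrib_left)
        \<comment> \<open>A closed walk of three steps has, up to rotation, one rise and one
          descent. Its positive steps therefore add up to its height, which exceeds 1 here.\<close>
        moreover have "max 0 y1 + max 0 y2 + max 0 y3 > 1"
          using False y0 by (auto simp: t0_def max_def min_def split: if_splits)
        ultimately have "s < l" if "s > 0"
          using mult_strict_left_mono[OF _ that, of 1 "max 0 y1 + max 0 y2 + max 0 y3"] by linarith
        then show ?thesis using l s(1) by (cases "s = 0") auto
      qed
      then show ?thesis by blast
    qed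
  qed
qed

text \<open>The momentum jumps along \<open>F\<close>, normal to the parallel sides (the upper one
  is a vertex when \<kappa> = 1), while the position runs back and forth along one segment of height
  1. Only the slant of this segment can keep it from fitting.\<close>

lemma two_bounce:
  assumes dual: "dual_basis e f E F" and \<kappa>: "0 \<le> \<kappa>" "\<kappa> \<le> 1" and T: "convex_body T"
    and Q: "Q = trapezoid_region a e f \<kappa>" "interior Q \<noteq> {}"
  obtains s A where "s > 0" "A \<in> T" "A + s *\<^sub>R F \<in> T"
    "0 \<le> c_EHZ (Q \<times> T) \<and> c_EHZ (Q \<times> T) \<le> s \<or>
     (\<forall>v l. 0 \<le> l \<longrightarrow> v \<in> T \<longrightarrow> v + l *\<^sub>R E \<in> T \<longrightarrow> v - (l * \<kappa>) *\<^sub>R F \<in> T \<longrightarrow> l < s)"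
proof -
  have convT: "convex T" and intT: "interior T \<noteq> {}" using T by (auto simp: convex_body_def)
  note D = dual_basisD[OF dual]
  have Fnz: "F \<noteq> 0" using D(4) by auto
  obtain s A u1 u2 u3 where s: "s > 0" and AT: "A \<in> T" "A + s *\<^sub>R F \<in> T" "A + s *\<^sub>R F \<in> T"
    and u': "\<And>y. y \<in> T \<Longrightarrow> inner u1 (y - A) \<le> 0"
      "\<And>y. y \<in> T \<Longrightarrow> inner u2 (y - (A + s *\<^sub>R F)) \<le> 0"
      "\<And>y. y \<in> T \<Longrightarrow> inner u3 (y - (A + s *\<^sub>R F)) \<le> 0"
    and sum0: "u1 + u2 + u3 = 0" and norm': "inner u2 F + inner u3 F = 1"
    by (rule maximal_homothet[OF T, of F F, OF disjI1[OF Fnz]]) (rule that)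
  define u where "u = u2 + u3"
  define B where "B = A + s *\<^sub>R F"
  have u1: "u1 = - u" using sum0 unfolding u_def add.assoc by (rule eq_neg_iff_add_eq_0[THEN iffD2])
  have uF: "inner u F = 1" using norm' by (simp add: u_def inner_add_left)
  have nA: "inner (- u) (y - A) \<le> 0" and nB: "inner u (y - B) \<le> 0" if "y \<in> T" for y
    using u'(1)[OF that] u'(2)[OF that] u'(3)[OF that] by (simp_all add: u1 u_def B_def inner_add_left)
  have wid: "inner u (y - z) \<le> s" if "y \<in> T" "z \<in> T" for y z
    using nB[OF that(1)] nA[OF that(2)] uF by (simp add: B_def inner_diff_right inner_add_right)
  \<comment> \<open>The horizontal displacement of the segment. From a bottom side of length 1 to a
    top side of length 1 - \<kappa> it must lie between -1 and 1 - \<kappa>; a segment leaning left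
    starts at distance \<open>- x\<close> from the corner \<open>a\<close>.\<close>
  define x where "x = inner u E"
  show thesis
  proof (rule that[OF s AT(1,2)])
    show "0 \<le> c_EHZ (Q \<times> T) \<and> c_EHZ (Q \<times> T) \<le> s \<or>
     (\<forall>v l. 0 \<le> l \<longrightarrow> v \<in> T \<longrightarrow> v + l *\<^sub>R E \<in> T \<longrightarrow> v - (l * \<kappa>) *\<^sub>R F \<in> T \<longrightarrow> l < s)"
    proof (cases "- 1 \<le> x \<and> x \<le> 1 - \<kappa>")
      case True
      define q0 q1 where "q0 = a + max 0 (- x) *\<^sub>R e" and "q1 = a + max 0 (- x) *\<^sub>R e + u"
      have coords: "inner E (q0 - a) = max 0 (- x)" "inner F (q0 - a) = 0"
        "inner E (q1 - a) = max 0 (- x) + x" "inner F (q1 - a) = 1"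
        using D(1-4) uF by (simp_all add: q0_def q1_def x_def inner_add_right inner_commute[of _ u])
      have qQ: "q0 \<in> Q" "q1 \<in> Q"
        unfolding Q(1) mem_trapezoid_region[OF dual] coords using True \<kappa> by auto
      define q where "q j = [q0, q1, q0] ! j" for j
      define p where "p j = [B, A, B] ! j" for j
      have q_simps: "q 0 = q0" "q (Suc 0) = q1" "q 2 = q0" "q (Suc (Suc 0)) = q0"
        and p_simps: "p 0 = B" "p (Suc 0) = A" "p 2 = B" "p (Suc (Suc 0)) = B"
        by (simp_all add: q_def p_def)
      have less2: "j < 2 \<Longrightarrow> j = 0 \<or> j = Suc 0" for j :: nat by linarith
      have le2: "j \<le> 2 \<Longrightarrow> j = 0 \<or> j = Suc 0 \<or> j = Suc (Suc 0)" for j :: nat by linarith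
      have dq: "q1 - q0 = u" "q0 - q1 = - u" by (simp_all add: q0_def q1_def)
      have i: "0 < (2::nat)" "q (Suc 0) \<noteq> q 0" using dq uF by (auto simp: q_simps)
      have nq: "inner (p (Suc j) - p j) (y - q (Suc j)) \<ge> 0" if j: "j < 2" and y: "y \<in> Q" for j y
      proof -
        have y': "0 \<le> inner F (y - a)" "inner F (y - a) \<le> 1"
          using y unfolding Q(1) mem_trapezoid_region[OF dual] by auto
        have split: "inner F (y - z) = inner F (y - a) - inner F (z - a)" for z
          by (simp add: inner_diff_right)
        have "inner (A - B) (y - q1) = s * (1 - inner F (y - a))"
          "inner (B - A) (y - q0) = s * inner F (y - a)"
          by (simp_all add: B_def split[of q0] split[of q1] coords right_diff_distrib)
        then show ?thesis using less2[OF j] y' s by (auto simp: q_simps p_simps)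
      qed
      have np: "inner (q (Suc j) - q j) (y - p j) \<le> 0" if j: "j < 2" and y: "y \<in> T" for j y
        using less2[OF j] nA[OF y] nB[OF y] by (auto simp: q_simps p_simps dq)
      have qm: "q j \<in> Q" "p j \<in> T" if "j \<le> 2" for j
        using le2[OF that] qQ AT by (auto simp: q_simps p_simps B_def)
      have "(\<Sum>j<2. inner (q (Suc j) - q j) (p j)) = s"
        using uF by (simp add: eval_nat_numeral q_simps p_simps dq B_def inner_add_right)
      then show ?thesis
        using c_EHZ_billiard[OF convex_trapezoid_region[OF dual, of a \<kappa>, folded Q(1)] convT Q(2) intT qm _ _ i np nq]
        by (simp add: q_simps p_simps)
    next
      case False
      \<comment> \<open>By \<open>wid\<close> the body has width at most \<open>s\<close> in
        direction \<open>u\<close>. A large \<open>x\<close> makes \<open>u\<close> vary by more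
        than \<open>l\<close> between \<open>v - (l * \<kappa>) *\<^sub>R F\<close> and
        \<open>v + l *\<^sub>R E\<close>; an \<open>x\<close> below -1 does so between
        \<open>v\<close> and \<open>v + l *\<^sub>R E\<close>.\<close>
      have "l < s" if l: "0 \<le> l" "v \<in> T" "v + l *\<^sub>R E \<in> T" "v - (l * \<kappa>) *\<^sub>R F \<in> T" for v l
      proof (cases "l = 0")
        case False
        with l have l0: "l > 0" by simp
        have "l * (x + \<kappa>) \<le> s" "l * (- x) \<le> s"
          using wid[OF l(3,4)] wid[OF l(2,3)] uF
          by (simp_all add: x_def inner_diff_right inner_add_right algebra_simps)
        moreover have "l * 1 < l * (x + \<kappa>) \<or> l * 1 < l * (- x)"
          using \<open>\<not> (- 1 \<le> x \<and> x \<le> 1 - \<kappa>)\<close> unfolding mult_less_cancel_left_pos[OF l0] by linarith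
        ultimately show ?thesis by auto
      qed (use s in simp)
      then show ?thesis by blast
    qed
  qed
qed

section \<open>Capacity and area of trapezoids\<close>


lemma dual_basis_exists:
  assumes "cross2 e f \<noteq> 0"
  obtains E F where "dual_basis e f E F"
proof
  let ?D = "cross2 e f"
  let ?E = "(1 / ?D) *\<^sub>R vector [f $ 2, - f $ 1] :: R2"
  let ?F = "(1 / ?D) *\<^sub>R vector [- e $ 2, e $ 1] :: R2"
  have "x = inner x ?E *\<^sub>R e + inner x ?F *\<^sub>R f" for x
  proof -
    have "?D * x $ i = (x $ 1 * f $ 2 - x $ 2 * f $ 1) * e $ i + (x $ 2 * e $ 1 - x $ 1 * e $ 2) * f $ i" for i
      using exhaust_2[of i] by (auto simp: cross2_def algebra_simps)
    then have "x $ i = ((x $ 1 * f $ 2 - x $ 2 * f $ 1) * e $ i + (x $ 2 * e $ 1 - x $ 1 * e $ 2) * f $ i) / ?D" for i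
      using assms by (simp add: nonzero_eq_divide_eq mult.commute)
    then show ?thesis
      by (simp add: vec_eq_iff inner_vec_def sum_2 add_divide_distrib diff_divide_distrib algebra_simps)
  qed
  moreover have "inner (vector [f $ 2, - f $ 1] :: R2) e = ?D" "inner (vector [f $ 2, - f $ 1] :: R2) f = 0"
    "inner (vector [- e $ 2, e $ 1] :: R2) e = 0" "inner (vector [- e $ 2, e $ 1] :: R2) f = ?D"
    by (simp_all add: inner_vec_def sum_2 cross2_def algebra_simps)
  ultimately show "dual_basis e f ?E ?F"
    using assms by (simp add: dual_basis_def)
qed

text \<open>The coordinates after exchanging the two lateral sides of the trapezoid. The shape
  parameter stays the same, so the second triangle is obtained from \<open>three_bounce\<close>
  without a new argument.\<close>

lemma dual_basis_reflect:
  assumes "dual_basis e f E F"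
  shows "dual_basis (- e) (f - \<kappa> *\<^sub>R e) (- E - \<kappa> *\<^sub>R F) F"
  unfolding dual_basis_def
proof (intro conjI allI)
  fix x
  have "x = inner x E *\<^sub>R e + inner x F *\<^sub>R f" using assms by (rule dual_basisD)
  then show "x = inner x (- E - \<kappa> *\<^sub>R F) *\<^sub>R - e + inner x F *\<^sub>R (f - \<kappa> *\<^sub>R e)"
    by (simp add: inner_diff_right algebra_simps)
qed (use dual_basisD(1-4)[OF assms] in \<open>auto simp: inner_diff_left inner_diff_right\<close>)

lemma trapezoid_region_reflect:
  assumes "dual_basis e f E F"
  shows "trapezoid_region a e f \<kappa> = trapezoid_region (a + e) (- e) (f - \<kappa> *\<^sub>R e) \<kappa>"
proof -
  have "inner F (x - (a + e)) = inner F (x - a)"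
    "inner (- E - \<kappa> *\<^sub>R F) (x - (a + e)) = 1 - inner E (x - a) - \<kappa> * inner F (x - a)" for x
    using dual_basisD(1-4)[OF assms]
    by (simp_all add: inner_diff_left inner_diff_right inner_add_right algebra_simps)
  then show ?thesis
    unfolding set_eq_iff mem_trapezoid_region[OF assms] mem_trapezoid_region[OF dual_basis_reflect[OF assms]]
    by auto
qed

lemma trapezoid_region_eq_hull:
  assumes dual: "dual_basis e f E F" and \<kappa>: "0 \<le> \<kappa>" "\<kappa> \<le> 1"
  shows "trapezoid_region a e f \<kappa> = convex hull {a, a + e, a + f, a + f + (1 - \<kappa>) *\<^sub>R e}"
    (is "_ = convex hull ?V")
proof
  show "convex hull ?V \<subseteq> trapezoid_region a e f \<kappa>"
  proof (intro hull_minimal convex_trapezoid_region[OF dual])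
    show "?V \<subseteq> trapezoid_region a e f \<kappa>"
      using dual_basisD(1-4)[OF dual] \<kappa> by (auto simp: mem_trapezoid_region[OF dual] inner_add_right)
  qed
next
  show "trapezoid_region a e f \<kappa> \<subseteq> convex hull ?V"
  proof
    fix x assume "x \<in> trapezoid_region a e f \<kappa>"
    then obtain s t where x: "x = a + s *\<^sub>R e + t *\<^sub>R f" and st: "0 \<le> t" "t \<le> 1" "0 \<le> s" "s + \<kappa> * t \<le> 1"
      by (auto simp: trapezoid_region_def)
    \<comment> \<open>The relative position in the horizontal slice, which has length 1 - \<kappa>
      t. At the tip of a triangle the quotient is 0 / 0 = 0, which is right since \<open>s\<close> =
      0 there.\<close>
    define \<mu> where "\<mu> = s / (1 - \<kappa> * t)"
    have s: "\<mu> * (1 - \<kappa> * t) = s" and \<mu>: "0 \<le> \<mu>" "\<mu> \<le> 1"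
      using st by (auto simp: \<mu>_def divide_le_eq)
    have hull: "(1 - u) *\<^sub>R y + u *\<^sub>R z \<in> convex hull ?V"
      if "y \<in> convex hull ?V" "z \<in> convex hull ?V" "0 \<le> u" "u \<le> 1" for y z u
      using convexD_alt[OF convex_convex_hull that] .
    have "(1 - t) *\<^sub>R ((1 - \<mu>) *\<^sub>R a + \<mu> *\<^sub>R (a + e))
        + t *\<^sub>R ((1 - \<mu>) *\<^sub>R (a + f) + \<mu> *\<^sub>R (a + f + (1 - \<kappa>) *\<^sub>R e)) \<in> convex hull ?V"
      using st \<mu> by (intro hull) (auto intro: hull_inc)
    also have "(1 - t) *\<^sub>R ((1 - \<mu>) *\<^sub>R a + \<mu> *\<^sub>R (a + e))
        + t *\<^sub>R ((1 - \<mu>) *\<^sub>R (a + f) + \<mu> *\<^sub>R (a + f + (1 - \<kappa>) *\<^sub>R e))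
      = a + (\<mu> * (1 - \<kappa> * t)) *\<^sub>R e + t *\<^sub>R f"
      by (simp add: algebra_simps)
    finally show "x \<in> convex hull ?V" unfolding s x .
  qed
qed

lemma convex_shrink:
  assumes "convex T" "v \<in> T" "v + l *\<^sub>R w \<in> T" "0 \<le> c" "c \<le> l" "0 < l"
  shows "v + c *\<^sub>R w \<in> T"
proof -
  have "(1 - c / l) *\<^sub>R v + (c / l) *\<^sub>R (v + l *\<^sub>R w) \<in> T"
    using assms by (intro convexD_alt) auto
  then show ?thesis using assms(6) by (simp add: algebra_simps)
qed

lemma c_EHZ_trapezoid_region_le:
  assumes dual: "dual_basis e f E F" and \<kappa>: "0 \<le> \<kappa>" "\<kappa> \<le> 1" and T: "convex_body T"
    and Q: "Q = trapezoid_region a e f \<kappa>" "interior Q \<noteq> {}"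
  shows "(c_EHZ (Q \<times> T))\<^sup>2 \<le> (2 - \<kappa>) * (\<bar>cross2 e f\<bar> * measure lebesgue T)"
proof -
  have compT: "compact T" and convT: "convex T" using T by (auto simp: convex_body_def)
  note D = dual_basisD[OF dual]
  define c where "c = c_EHZ (Q \<times> T)"
  define E' where "E' = - E - \<kappa> *\<^sub>R F"
  note dual' = dual_basis_reflect[OF dual, of \<kappa>, folded E'_def]
  have Q': "Q = trapezoid_region (a + e) (- e) (f - \<kappa> *\<^sub>R e) \<kappa>"
    unfolding Q(1) by (rule trapezoid_region_reflect[OF dual])
  obtain l1 v1 where 1: "l1 > 0" "v1 \<in> T" "v1 + l1 *\<^sub>R E \<in> T" "v1 - (l1 * \<kappa>) *\<^sub>R F \<in> T"
    "0 \<le> c \<and> c \<le> l1 \<or> (\<forall>A s. 0 \<le> s \<longrightarrow> A \<in> T \<longrightarrow> A + s *\<^sub>R F \<in> T \<longrightarrow> s < l1)"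
    unfolding c_def by (rule three_bounce[OF dual \<kappa> T Q])
  obtain l2 v2 where 2: "l2 > 0" "v2 \<in> T" "v2 + l2 *\<^sub>R E' \<in> T" "v2 - (l2 * \<kappa>) *\<^sub>R F \<in> T"
    "0 \<le> c \<and> c \<le> l2 \<or> (\<forall>A s. 0 \<le> s \<longrightarrow> A \<in> T \<longrightarrow> A + s *\<^sub>R F \<in> T \<longrightarrow> s < l2)"
    unfolding c_def by (rule three_bounce[OF dual' \<kappa> T Q' Q(2)])
  obtain s A where 3: "s > 0" "A \<in> T" "A + s *\<^sub>R F \<in> T"
    "0 \<le> c \<and> c \<le> s \<or>
     (\<forall>v l. 0 \<le> l \<longrightarrow> v \<in> T \<longrightarrow> v + l *\<^sub>R E \<in> T \<longrightarrow> v - (l * \<kappa>) *\<^sub>R F \<in> T \<longrightarrow> l < s)"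
    unfolding c_def by (rule two_bounce[OF dual \<kappa> T Q])
  \<comment> \<open>Strictness prevents a circle: \<open>s < l1\<close> and \<open>l1 < s\<close>
    exclude each other, so one of the first and third alternatives bounds \<open>c\<close> directly
    and the other follows. The second triangle need only be compared with \<open>s\<close>.\<close>
  have alt1: "0 \<le> c \<and> c \<le> l1 \<or> s < l1" using 1(5) 3(1,2,3) by auto
  have alt2: "0 \<le> c \<and> c \<le> l2 \<or> s < l2" using 2(5) 3(1,2,3) by auto
  have alt3: "0 \<le> c \<and> c \<le> s \<or> l1 < s" using 3(4) 1(1-4) by auto
  have c: "0 \<le> c" "c \<le> l1" "c \<le> l2" "c \<le> s" using alt1 alt2 alt3 by linarith+
  show ?thesis
  proof (cases "c = 0")
    case True
    then show ?thesis using \<kappa> by (simp add: c_def)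
  next
    case False
    \<comment> \<open>All three figures are shrunk to the common size \<open>c\<close>, the single
      scale of the area estimate.\<close>
    note shrink = convex_shrink[OF convT _ _ c(1)]
    have chord0: "chord T e f (inner A e) c"
      unfolding chord_def using shrink[OF 3(2,3) c(4) 3(1)] 3(2) D(1-4)
      by (intro bexI[of _ A] bexI[of _ "A + c *\<^sub>R F"]) (auto simp: inner_add_left)
    have low: "v - (c * \<kappa>) *\<^sub>R F \<in> T" if "v \<in> T" "v - (l * \<kappa>) *\<^sub>R F \<in> T" "c \<le> l" "0 < l" for v l
      using shrink[of v l "- \<kappa> *\<^sub>R F"] that by simp
    have chordk: "chord T e f (inner v e) (c * \<kappa>)" if "v \<in> T" "v - (c * \<kappa>) *\<^sub>R F \<in> T" for v
      unfolding chord_def using that D(1-4)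
      by (intro bexI[of _ "v - (c * \<kappa>) *\<^sub>R F"] bexI[of _ v]) (auto simp: inner_diff_left)
    have chord1: "chord T e f (inner v1 e + c) 0"
      unfolding chord_def using shrink[OF 1(2,3) c(2) 1(1)] D(1-4)
      by (intro bexI[of _ "v1 + c *\<^sub>R E"]) (auto simp: inner_add_left)
    have chord2: "chord T e f (inner v2 e - c) 0"
      unfolding chord_def using shrink[OF 2(2,3) c(3) 2(1)] D(1-4)
      by (intro bexI[of _ "v2 + c *\<^sub>R E'"]) (auto simp: inner_add_left E'_def inner_diff_left)
    have "e \<noteq> 0" using D(1) by auto
    then have "c\<^sup>2 \<le> (2 - \<kappa>) * (\<bar>cross2 e f\<bar> * measure lebesgue T)"
      using False c(1)
      by (intro area_of_chords[OF compT convT _ \<kappa> _ chord0 chordk[OF 1(2) low[OF 1(2,4) c(2) 1(1)]] chord1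
            chordk[OF 2(2) low[OF 2(2,4) c(3) 2(1)]] chord2]) auto
    then show ?thesis by (simp add: c_def)
  qed
qed

lemma trapezoid_region_measure_ge:
  assumes dual: "dual_basis e f E F" and \<kappa>: "0 \<le> \<kappa>" "\<kappa> \<le> 1"
  shows "(2 - \<kappa>) * \<bar>cross2 e f\<bar> / 2 \<le> measure lebesgue (trapezoid_region a e f \<kappa>)"
proof -
  let ?A = "a" and ?B = "a + e" and ?C = "a + f" and ?D = "a + f + (1 - \<kappa>) *\<^sub>R e"
  note hull = trapezoid_region_eq_hull[OF dual \<kappa>, of a]
  have eqs: "cross2 (?C - ?B) (?A - ?B) = cross2 e f"
    "cross2 (?C - ?B) (?D - ?B) = - ((1 - \<kappa>) * cross2 e f)"
    by (simp_all add: cross2_def algebra_simps)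
  have "trapezoid_region a e f \<kappa> \<in> lmeasurable"
    unfolding hull by (intro lmeasurable_compact compact_convex_hull finite_imp_compact) simp
  moreover have "cross2 e f * - ((1 - \<kappa>) * cross2 e f) \<le> 0"
  proof -
    have "0 \<le> (1 - \<kappa>) * (cross2 e f)\<^sup>2" using \<kappa> by simp
    then show ?thesis by (simp add: power2_eq_square mult.left_commute)
  qed
  moreover have "?A \<in> trapezoid_region a e f \<kappa>" "?B \<in> trapezoid_region a e f \<kappa>"
    "?C \<in> trapezoid_region a e f \<kappa>" "?D \<in> trapezoid_region a e f \<kappa>"
    unfolding hull by (auto intro: hull_inc)
  ultimately have "(\<bar>cross2 e f\<bar> + \<bar>- ((1 - \<kappa>) * cross2 e f)\<bar>) / 2 \<le> measure lebesgue (trapezoid_region a e f \<kappa>)"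
    using quadrilateral_measure_le[OF convex_trapezoid_region[OF dual], of a \<kappa> ?A ?B ?C ?D] unfolding eqs by simp
  then show ?thesis using \<kappa> by (simp add: abs_mult algebra_simps)
qed

lemma cross2_eq_0_imp_parallel:
  assumes "cross2 x y = 0" "x \<noteq> 0"
  obtains r where "y = r *\<^sub>R x"
proof -
  have "inner x x * y $ i = inner x y * x $ i" for i
    using assms(1) exhaust_2[of i] by (auto simp: cross2_def inner_vec_def sum_2 algebra_simps)
  then have "y = (inner x y / inner x x) *\<^sub>R x"
    using assms(2) by (simp add: vec_eq_iff nonzero_eq_divide_eq mult.commute)
  then show thesis by (rule that)
qed

lemma convex_position_imp_cross2_nonzero:
  assumes ab: "a \<noteq> b" and pos: "a \<notin> closed_segment b c" "b \<notin> closed_segment a c" "c \<notin> closed_segment a b"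
  shows "cross2 (b - a) (c - a) \<noteq> 0"
proof
  assume "cross2 (b - a) (c - a) = 0"
  then obtain r where r: "c - a = r *\<^sub>R (b - a)"
    using cross2_eq_0_imp_parallel ab by (metis right_minus_eq)
  then have c: "c = a + r *\<^sub>R (b - a)" by (simp add: algebra_simps)
  consider "r < 0" | "0 \<le> r" "r \<le> 1" | "1 < r" by linarith
  then show False
  proof cases
    case 1
    have "a = (1 - 1 / (1 - r)) *\<^sub>R b + (1 / (1 - r)) *\<^sub>R c"
    proof -
      have "(1 - r) *\<^sub>R a = (- r) *\<^sub>R b + c" by (simp add: c algebra_simps)
      then have "(1 / (1 - r)) *\<^sub>R ((1 - r) *\<^sub>R a) = (1 / (1 - r)) *\<^sub>R ((- r) *\<^sub>R b + c)" by simp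
      moreover have "1 - 1 / (1 - r) = - r / (1 - r)" using 1 by (simp add: field_simps)
      ultimately show ?thesis using 1 by (simp add: scaleR_add_right scaleR_diff_right)
    qed
    then have "a \<in> closed_segment b c"
      unfolding in_segment using 1 by (intro exI[of _ "1 / (1 - r)"]) simp
    with pos show False by simp
  next
    case 2
    then have "c \<in> closed_segment a b"
      unfolding in_segment c by (intro exI[of _ r]) (simp add: algebra_simps)
    with pos show False by simp
  next
    case 3
    then have "b \<in> closed_segment a c"
      unfolding in_segment c by (intro exI[of _ "1 / r"]) (simp add: algebra_simps)
    with pos show False by simp
  qed
qed

text \<open>The ratio of the parallel sides is \<open>k\<close>, hence \<kappa> = 1 -
  \<open>k\<close>. The cross product cannot vanish, since otherwise one of \<open>a\<close>,
  \<open>b\<close>, \<open>c\<close> would lie between the other two.\<close>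

lemma quadrilateral_trapezoid_region:
  fixes a b c d :: R2
  assumes card: "card {a, b, c, d} = 4"
    and pos: "\<forall>v\<in>{a, b, c, d}. v \<notin> convex hull ({a, b, c, d} - {v})"
    and k: "d - c = k *\<^sub>R (b - a)" "0 < k" "k \<le> 1"
  obtains e f \<kappa> where "0 \<le> \<kappa>" "\<kappa> \<le> 1" "cross2 e f \<noteq> 0"
    "convex hull {a, b, c, d} = convex hull {a, a + e, a + f, a + f + (1 - \<kappa>) *\<^sub>R e}"
proof (rule that[of "1 - k" "b - a" "c - a"])
  have dist: "a \<noteq> b" "a \<noteq> c" "b \<noteq> c"
    using card by (auto simp: card_insert_if split: if_splits)
  have seg: "x \<notin> closed_segment y z" if "x \<in> {a, b, c, d}" "y \<in> {a, b, c, d} - {x}" "z \<in> {a, b, c, d} - {x}" for x y z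
    using pos that hull_mono[of "{y, z}" "{a, b, c, d} - {x}" convex]
    unfolding segment_convex_hull by blast
  show "cross2 (b - a) (c - a) \<noteq> 0"
    using dist by (intro convex_position_imp_cross2_nonzero seg) auto
  have "d = c + k *\<^sub>R (b - a)" using k(1) by (simp add: algebra_simps)
  then show "convex hull {a, b, c, d} = convex hull {a, a + (b - a), a + (c - a), a + (c - a) + (1 - (1 - k)) *\<^sub>R (b - a)}"
    by simp
qed (use k in auto)

lemma trapezoid_cases:
  assumes "trapezoid Q"
  obtains a e f \<kappa> where "0 \<le> \<kappa>" "\<kappa> \<le> 1" "cross2 e f \<noteq> 0"
    "Q = convex hull {a, a + e, a + f, a + f + (1 - \<kappa>) *\<^sub>R e}"
  using assms unfolding trapezoid_def
proof (elim disjE exE conjE)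
  fix a b c assume abc: "\<not> collinear {a, b, c}" "Q = convex hull {a, b, c}"
  have "cross2 (b - a) (c - a) \<noteq> 0"
  proof
    assume *: "cross2 (b - a) (c - a) = 0"
    have "b - a \<noteq> 0" using abc(1) by auto
    then obtain r where "c - a = r *\<^sub>R (b - a)" using * cross2_eq_0_imp_parallel by blast
    then have "collinear {0, b - a, c - a}" unfolding collinear_lemma by blast
    then have "collinear {b, a, c}" using collinear_3[of b a c] by simp
    with abc(1) show False by (simp add: insert_commute)
  qed
  then show thesis
    using that[of 1 "b - a" "c - a" a] abc(2) by (simp add: insert_commute)
next
  fix a b c d and k :: real
  assume q: "card {a, b, c, d} = 4" "Q = convex hull {a, b, c, d}"
    "\<forall>v\<in>{a, b, c, d}. v \<notin> convex hull ({a, b, c, d} - {v})" and k: "d - c = k *\<^sub>R (b - a)"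
  have "c \<noteq> d" using q(1) by (auto simp: card_insert_if split: if_splits)
  then have "k \<noteq> 0" using k by auto
  note thesisI = that
  have result: thesis
    if V: "{a', b', c', d'} = {a, b, c, d}" and k': "d' - c' = k' *\<^sub>R (b' - a')" "0 < k'" "k' \<le> 1" for a' b' c' d' k'
  proof -
    obtain e f \<kappa> where *: "0 \<le> \<kappa>" "\<kappa> \<le> 1" "cross2 e f \<noteq> 0"
      "convex hull {a', b', c', d'} = convex hull {a', a' + e, a' + f, a' + f + (1 - \<kappa>) *\<^sub>R e}"
      by (rule quadrilateral_trapezoid_region[OF q(1,3)[folded V] k'])
    show thesis by (rule thesisI[OF *(1-3)]) (simp only: q(2) V[symmetric] *(4))
  qed
  have swap: "c - d = (- k) *\<^sub>R (b - a)" using k by (simp add: algebra_simps)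
  have inv: "b - a = (1 / k) *\<^sub>R (d - c)" using k \<open>k \<noteq> 0\<close> by simp
  then have invswap: "a - b = (- (1 / k)) *\<^sub>R (d - c)" by (simp add: algebra_simps)
  \<comment> \<open>Relabelling brings the ratio into the range from 0 to 1: swapping
    \<open>c\<close> and \<open>d\<close> changes its sign, exchanging the two parallel sides
    inverts it.\<close>
  consider "0 < k" "k \<le> 1" | "1 < k" | "- 1 \<le> k" "k < 0" | "k < - 1" using \<open>k \<noteq> 0\<close> by linarith
  then show thesis
  proof cases
    case 1 then show thesis using result[OF refl k] by blast
  next
    case 2 then show thesis using result[of c d a b, OF _ inv] by (simp add: insert_commute)
  next
    case 3 then show thesis using result[of a b d c, OF _ swap] by (simp add: insert_commute)
  next
    case 4
    then have "- 1 \<le> 1 / k" by (simp add: field_simps)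
    with 4 show thesis using result[of c d b a, OF _ invswap] by (simp add: insert_commute)
  qed
qed

lemma measure_lebesgue_Times:
  fixes A :: "'a::euclidean_space set" and B :: "'b::euclidean_space set"
  assumes "compact A" "compact B"
  shows "measure lebesgue (A \<times> B) = measure lebesgue A * measure lebesgue B"
proof -
  have borel: "A \<in> sets borel" "B \<in> sets borel" "A \<times> B \<in> sets borel"
    using assms by (auto intro!: borel_compact compact_Times)
  have "measure lborel (A \<times> B) = measure (lborel \<Otimes>\<^sub>M lborel) (A \<times> B)"
    by (simp add: lborel_prod)
  also have "\<dots> = measure lborel A * measure lborel B"
    using borel by (simp add: measure_def lborel.emeasure_pair_measure_Times enn2real_mult)
  finally show ?thesis using borel by (simp add: measure_completion)
qed

theorem theorem1p1:
  fixes Q T :: "R2 set"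
  assumes "trapezoid Q" and "convex_body T"
  shows "measure lebesgue (Q \<times> T) \<ge> (c_EHZ (Q \<times> T))\<^sup>2 / 2"
proof -
  obtain a e f \<kappa> where \<kappa>: "0 \<le> \<kappa>" "\<kappa> \<le> 1" and ef: "cross2 e f \<noteq> 0"
    and hull: "Q = convex hull {a, a + e, a + f, a + f + (1 - \<kappa>) *\<^sub>R e}"
    using trapezoid_cases[OF assms(1)] .
  obtain E F where dual: "dual_basis e f E F" using dual_basis_exists[OF ef] .
  have Q: "Q = trapezoid_region a e f \<kappa>" unfolding hull trapezoid_region_eq_hull[OF dual \<kappa>] ..
  have area: "(2 - \<kappa>) * \<bar>cross2 e f\<bar> / 2 \<le> measure lebesgue Q"
    unfolding Q by (rule trapezoid_region_measure_ge[OF dual \<kappa>])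
  have "0 < (2 - \<kappa>) * \<bar>cross2 e f\<bar> / 2" using \<kappa> ef by simp
  with area have "measure lebesgue Q \<noteq> 0" by linarith
  then have "interior Q \<noteq> {}"
    using negligible_convex_interior[of Q] negligible_imp_measure0[of Q] hull by (auto simp: convex_convex_hull)
  then have "(c_EHZ (Q \<times> T))\<^sup>2 \<le> (2 - \<kappa>) * (\<bar>cross2 e f\<bar> * measure lebesgue T)"
    using c_EHZ_trapezoid_region_le[OF dual \<kappa> assms(2) Q] by blast
  also have "\<dots> = 2 * (((2 - \<kappa>) * \<bar>cross2 e f\<bar> / 2) * measure lebesgue T)" by simp
  also have "\<dots> \<le> 2 * (measure lebesgue Q * measure lebesgue T)"
    using area by (intro mult_left_mono mult_right_mono) auto
  also have "measure lebesgue Q * measure lebesgue T = measure lebesgue (Q \<times> T)"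
  proof (rule measure_lebesgue_Times[symmetric])
    show "compact Q" unfolding hull by (intro compact_convex_hull finite_imp_compact) simp
    show "compact T" using assms(2) by (simp add: convex_body_def)
  qed
  finally show ?thesis by simp
qed

end
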